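(* Let $1\le p\le\infty$, $\alpha>0$ and $\rho\in\mathbb{R}$. For an entire function $f$ on $\mathbb{C}^n$ let $|\nabla^m f|=\sum_{|\nu|=m}|\partial^\nu f|$, where $|\nu|=\nu_1+\cdots+\nu_n$. Then the following assertions are equivalent: (1) $f\in F^p_{\alpha,\rho}$. (2) For any $k\ge 1$, $|\nabla^k f|\in L^p_{\alpha,\rho-k(2\ell-1)}$. (3) For some $k\ge 1$, $|\nabla^k f|\in L^p_{\alpha,\rho-k(2\ell-1)}$. Moreover, for $k\ge1$, $$\|f\|_{F^p_{\alpha,\rho}}\simeq \sum_{m=0}^{k-1}|\nabla^m f(0)|+\|\nabla^k f\|_{L^p_{\alpha,\rho-k(2\ell-1)}}.$$
   Context: Fix an integer $n\ge 1$ and a real number $\ell\ge 1$. $dV$ is Lebesgue measure on $\mathbb{C}^n$ normalized so that the unit ball has measure $1$. For $1\le p<\infty$, $\alpha\ge 0$, $\rho\in\mathbb{R}$, $L^p_{\alpha,\rho}$ is the space of measurable functions $f$ on $\mathbb{C}^n$ with $\|f\|_{L^p_{\alpha,\rho}}^p=\int_{\mathbb{C}^n}|f(z)(1+|z|)^{\rho}e^{-\frac{\alpha}{2}|z|^{2\ell}}|^p\,dV(z)<\infty$; $L^\infty_{\alpha,\rho}$ is the space of measurable $f$ with $\|f\|_{L^\infty_{\alpha,\rho}}=\operatorname{ess\,sup}_{z}|f(z)|(1+|z|)^{\rho}e^{-\frac{\alpha}{2}|z|^{2\ell}}<\infty$. For $\alpha>0$, $F^p_{\alpha,\rho}$ is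 the space of entire functions on $\mathbb{C}^n$ belonging to $L^p_{\alpha,\rho}$, with the same norm. $\nu$ ranges over multi-indices in $\mathbb{N}^n$ ($0\in\mathbb{N}$), $\partial^\nu$ denotes the corresponding holomorphic partial derivative, $k$ is an integer, and $\|\nabla^k f\|_{L^p_{\alpha,\rho}}$ means the norm of the function $|\nabla^k f|$. $\Phi\simeq\Psi$ means $C^{-1}\Psi\le\Phi\le C\Psi$ with a constant $C>0$ independent of $f$. *)

theory Defs
  imports "HOL-Probability.Essential_Supremum"
begin

text \<open>Complex \<open>n\<close>-space is the type \<^typ>\<open>complex ^ 'n\<close> with \<open>n = CARD('n)\<close>; its norm is the
  Euclidean (Hermitian) one.\<close>

text \<open>Complex differentiability at every point: the real Frechet derivative exists and is
  complex linear.\<close>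

definition entire :: "(complex ^ 'n \<Rightarrow> complex) \<Rightarrow> bool" where
  "entire f \<longleftrightarrow> (\<forall>z. \<exists>D. (f has_derivative D) (at z) \<and> (\<forall>c v. D (c *s v) = c * D v))"

definition partial :: "'n \<Rightarrow> (complex ^ 'n \<Rightarrow> complex) \<Rightarrow> complex ^ 'n \<Rightarrow> complex" where
  "partial j f z = deriv (\<lambda>w. f (z + axis j w)) 0"

text \<open>A finite index type carries no canonical order, so some enumeration of it is chosen in order to
  compose the partial derivatives. For entire functions the partial derivatives commute and
  \<open>mpartial\<close> does not depend on the choice.\<close>

definition coordinates :: "'n::finite list" where
  "coordinates = (SOME js. distinct js \<and> set js = UNIV)"

lemma distinct_coordinates: "distinct (coordinates :: 'n::finite list)"
  and set_coordinates: "set (coordinates :: 'n::finite list) = UNIV"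
  using someI_ex[OF finite_distinct_list[OF finite[of "UNIV :: 'n set"]]]
  unfolding coordinates_def by (metis (mono_tags, lifting) verit_sko_ex_indirect)+

definition mpartial :: "('n::finite \<Rightarrow> nat) \<Rightarrow> (complex ^ 'n \<Rightarrow> complex) \<Rightarrow> complex ^ 'n \<Rightarrow> complex" where
  "mpartial \<nu> f = foldr (\<lambda>j. partial j ^^ \<nu> j) coordinates f"

text \<open>\<open>nabla_abs m f z\<close> is \<open>|\<nabla>\<^sup>m f|(z)\<close>.\<close>

definition nabla_abs :: "nat \<Rightarrow> (complex ^ 'n::finite \<Rightarrow> complex) \<Rightarrow> complex ^ 'n \<Rightarrow> real" where
  "nabla_abs m f z = (\<Sum>\<nu> | sum \<nu> UNIV = m. norm (mpartial \<nu> f z))"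

definition dV :: "(complex ^ 'n::finite) measure" where
  "dV = scale_measure (inverse (emeasure lebesgue (ball (0 :: complex ^ 'n) 1))) lebesgue"

text \<open>The norm of \<open>L\<^sup>p\<^sub>\<alpha>\<^sub>,\<^sub>\<rho>\<close>, with value \<open>\<infinity>\<close> when it is not finite; the exponent \<open>p\<close> ranges over
  \<open>[1, \<infinity>]\<close>, and the real number \<open>l\<close> is the growth parameter of the weight. The inner
  conditional is the \<open>1/p\<close>-th power in \<open>[0, \<infinity>]\<close>.\<close>

definition wnorm :: "real \<Rightarrow> ennreal \<Rightarrow> real \<Rightarrow> real \<Rightarrow>
    (complex ^ 'n::finite \<Rightarrow> 'b::real_normed_vector) \<Rightarrow> ennreal" where
  "wnorm l p \<alpha> \<rho> f =
    (let g = (\<lambda>z. norm (f z) * (1 + norm z) powr \<rho> * exp (- (\<alpha> / 2) * norm z powr (2 * l))) in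
     if p = \<infinity> then esssup dV (\<lambda>z. ennreal (g z))
     else let I = (\<integral>\<^sup>+ z. ennreal (g z powr enn2real p) \<partial>dV) in
       if I = \<infinity> then \<infinity> else ennreal (enn2real I powr (1 / enn2real p)))"

definition Lspace :: "real \<Rightarrow> ennreal \<Rightarrow> real \<Rightarrow> real \<Rightarrow>
    (complex ^ 'n::finite \<Rightarrow> 'b::real_normed_vector) set" where
  "Lspace l p \<alpha> \<rho> = {f. f \<in> borel_measurable lebesgue \<and> wnorm l p \<alpha> \<rho> f < \<infinity>}"

definition Fock :: "real \<Rightarrow> ennreal \<Rightarrow> real \<Rightarrow> real \<Rightarrow> (complex ^ 'n::finite \<Rightarrow> complex) set" where
  "Fock l p \<alpha> \<rho> = {f. entire f \<and> f \<in> Lspace l p \<alpha> \<rho>}"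

end

theory Submission
  imports Defs "HOL-Complex_Analysis.Cauchy_Integral_Formula"
begin

text \<open>Write \<open>m = 2 * l - 1\<close>, \<open>r(z) = (1 + |z|)\<^sup>-\<^sup>m\<close> and \<open>W\<^sub>\<rho>\<close> for the weight
  \<open>(1 + |z|)\<^sup>\<rho> exp (- \<alpha>/2 |z|\<^sup>2\<^sup>l)\<close>, so that \<open>W\<^sub>\<rho>\<^sub>-\<^sub>m = W\<^sub>\<rho> r\<close>. The exponent \<open>|z|\<^sup>2\<^sup>l\<close> has slope of
  order \<open>|z|\<^sup>m\<close>; hence \<open>r(z)\<close> is the length on which \<open>W\<^sub>\<rho>\<close> is essentially constant, and a
  derivative should cost a factor \<open>1 / r\<close>. That is the whole theorem for \<open>k = 1\<close>; since the partial
  derivatives of an entire function are entire and commute, the general case follows by iterating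
  it with \<open>\<rho>\<close> replaced by \<open>\<rho> - m\<close>, \<open>\<rho> - 2 m\<close>, and so on.

  From the function to the derivative (\<open>fnorm_partial_le\<close>): Cauchy's estimate on circles of radius
  between \<open>r(z) / 2\<close> and \<open>r(z)\<close> in a coordinate direction, where the weights at the centre and on the
  circle are comparable.

  From the derivative to the function (\<open>fnorm_le_value_partials\<close>): \<open>f(z) - f(0)\<close> is the integral of
  the derivative along the segment from \<open>0\<close> to \<open>z\<close>. On the part outside the unit ball the ratio
  \<open>W\<^sub>\<rho>(z) / W\<^sub>\<rho>(t z)\<close> decays exponentially in \<open>|z|\<^sup>2\<^sup>l (1 - t)\<close>, so only a piece of length of order
  \<open>|z|\<^sup>-\<^sup>m\<close> near \<open>z\<close> counts. Inside the unit ball the values of the derivative are bounded by its norm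
  through the mean value property on balls (\<open>entire_value_le_fnorm\<close>); this keeps the dilations by
  small \<open>t\<close>, which distort volume by \<open>t\<close> to the power of minus the dimension, away from the origin.

  In both directions the outcome is a pointwise inequality \<open>F(z) \<le> \<integral> k(z, t) G(\<tau>(z, t)) dt\<close> between
  weighted functions, in which \<open>\<tau>(\<sqdot>, t)\<close> is a translation or a dilation. The Schur test
  (\<open>Schur_test\<close>) turns it into an inequality of \<open>L\<^sup>p\<close> norms for all \<open>1 \<le> p \<le> \<infinity>\<close> at once, from uniform
  bounds on the integrals in \<open>t\<close> of the kernel and of its transport under \<open>\<tau>\<close>.

  All estimates are proved for Lebesgue measure; the normalisation of \<^const>\<open>dV\<close> only multiplies the
  norms by a constant (\<open>wnorm_eq_fnorm\<close>).\<close>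

section \<open>Norms of functions with values in the extended half-line\<close>

text \<open>Real powers on \<open>[0, \<infinity>]\<close>, with \<open>\<infinity>\<close> fixed by every power. Working with values in \<open>[0, \<infinity>]\<close> lets
  the inequalities below be stated for integrals that are not known to be finite.\<close>

definition epow :: "ennreal \<Rightarrow> real \<Rightarrow> ennreal" where
  "epow x p = (if x = \<infinity> then \<infinity> else ennreal (enn2real x powr p))"

lemma epow_ennreal: "0 \<le> x \<Longrightarrow> epow (ennreal x) p = ennreal (x powr p)"
  by (simp add: epow_def)

lemma epow_top [simp]: "epow top p = top"
  by (simp add: epow_def)

lemma epow_0 [simp]: "epow 0 p = 0"
  by (simp add: epow_def)

lemma epow_mono: "0 \<le> p \<Longrightarrow> x \<le> y \<Longrightarrow> epow x p \<le> epow y p"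
  unfolding epow_def
  by (auto intro!: ennreal_leI powr_mono2 enn2real_mono simp: top.not_eq_extremum top_unique)

lemma epow_mult:
  assumes "0 < p"
  shows "epow (x * y) p = epow x p * epow y p"
  by (cases x; cases y) 
     (auto simp: epow_def ennreal_mult_top ennreal_top_mult ennreal_mult_eq_top_iff enn2real_mult powr_mult ennreal_mult'
       top_unique)

lemma epow_epow_inverse: "0 < p \<Longrightarrow> epow (epow x p) (1 / p) = x"
  by (cases x) (auto simp: epow_def powr_powr)

lemma measurable_epow [measurable]: "(\<lambda>x. epow x p) \<in> borel_measurable borel"
  unfolding epow_def infinity_ennreal_def by measurable

definition Lnorm :: "'a measure \<Rightarrow> ennreal \<Rightarrow> ('a \<Rightarrow> ennreal) \<Rightarrow> ennreal" where
  "Lnorm M p g = (if p = \<infinity> then esssup M g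
     else epow (\<integral>\<^sup>+z. epow (g z) (enn2real p) \<partial>M) (1 / enn2real p))"

lemma exponent_ge_1:
  assumes "1 \<le> p" "p \<noteq> (\<infinity> :: ennreal)"
  shows "1 \<le> enn2real p"
  using assms enn2real_mono[of 1 p] by (simp add: less_top)

lemma Lnorm_finite_exponent_le:
  assumes "1 \<le> p" "p \<noteq> \<infinity>" and "(\<integral>\<^sup>+z. epow (g z) (enn2real p) \<partial>M) \<le> epow A (enn2real p)"
  shows "Lnorm M p g \<le> A"
proof -
  have "1 \<le> enn2real p" using assms exponent_ge_1 by blast
  then have "Lnorm M p g \<le> epow (epow A (enn2real p)) (1 / enn2real p)"
    unfolding Lnorm_def using assms by (auto intro!: epow_mono)
  then show ?thesis using \<open>1 \<le> enn2real p\<close> by (simp add: epow_epow_inverse)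
qed

lemma epow_Lnorm:
  assumes "1 \<le> p" "p \<noteq> \<infinity>"
  shows "epow (Lnorm M p g) (enn2real p) = (\<integral>\<^sup>+z. epow (g z) (enn2real p) \<partial>M)"
proof -
  have "1 \<le> enn2real p" using assms exponent_ge_1 by blast
  then show ?thesis
    using epow_epow_inverse[of "1 / enn2real p"] assms by (simp add: Lnorm_def)
qed

lemma Lnorm_mono:
  assumes "1 \<le> p" "f \<in> borel_measurable M" "\<And>z. z \<in> space M \<Longrightarrow> f z \<le> g z"
  shows "Lnorm M p f \<le> Lnorm M p g"
proof (cases "p = \<infinity>")
  case True
  then show ?thesis using assms by (auto simp: Lnorm_def intro!: esssup_AE_mono)
next
  case False
  show ?thesis
    by (rule Lnorm_finite_exponent_le)
       (use assms False in \<open>auto simp: epow_Lnorm intro!: nn_integral_mono epow_mono\<close>)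
qed

lemma Lnorm_cmult:
  assumes "1 \<le> p" and [measurable]: "f \<in> borel_measurable M"
  shows "Lnorm M p (\<lambda>z. c * f z) \<le> c * Lnorm M p f"
proof (cases "p = \<infinity>")
  case True
  have "AE z in M. f z \<le> esssup M f" by (rule esssup_AE)
  then have "AE z in M. c * f z \<le> c * esssup M f"
    by eventually_elim (rule mult_left_mono, auto)
  then show ?thesis using True by (auto simp: Lnorm_def)
next
  case False
  have "1 \<le> enn2real p" using assms False exponent_ge_1 by blast
  then show ?thesis
    using assms False
    by (intro Lnorm_finite_exponent_le) (auto simp: epow_Lnorm epow_mult nn_integral_cmult)
qed

lemma powr_convex_combination:
  assumes "1 \<le> p" "0 \<le> u" "0 \<le> v" "0 \<le> \<mu>" "0 \<le> \<nu>" "\<mu> + \<nu> = (1::real)"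
  shows "(\<mu> * u + \<nu> * v) powr p \<le> \<mu> * u powr p + \<nu> * v powr p"
proof -
  have small: "c powr p \<le> c" if "0 \<le> c" "c \<le> 1" for c
    using that assms powr_mono'[of 1 p c] by simp
  show ?thesis
  proof (cases "u = 0 \<or> v = 0")
    case True
    have "\<mu> \<le> 1" "\<nu> \<le> 1" using assms by auto
    with True show ?thesis
      using assms small[of \<mu>] small[of \<nu>] by (auto simp: powr_mult intro!: mult_right_mono)
  next
    case False
    have \<mu>: "\<mu> = 1 - \<nu>" using assms by simp
    from False show ?thesis
      using assms convex_onD[OF powr_convex[OF assms(1)], of \<nu> u v]
      by (simp add: \<mu>)
  qed
qed

text \<open>Minkowski's inequality by convexity instead of duality: if \<open>a\<close> and \<open>b\<close> exceed the two norms, then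
  \<open>(f + g) / (a + b)\<close> is the convex combination of \<open>f / a\<close> and \<open>g / b\<close> with weights \<open>a / (a + b)\<close> and
  \<open>b / (a + b)\<close>, so its \<open>p\<close>-th power integrates to at most \<open>1\<close>. Taking \<open>a\<close> and \<open>b\<close> slightly larger than
  the norms covers the case that a norm is zero.\<close>

lemma Lnorm_triangle:
  assumes p: "1 \<le> p" and [measurable]: "f \<in> borel_measurable M" "g \<in> borel_measurable M"
  shows "Lnorm M p (\<lambda>z. f z + g z) \<le> Lnorm M p f + Lnorm M p g"
proof (cases "p = \<infinity>")
  case True
  have "AE z in M. f z \<le> esssup M f" "AE z in M. g z \<le> esssup M g" by (rule esssup_AE)+
  then have "AE z in M. f z + g z \<le> esssup M f + esssup M g"
    by eventually_elim (rule add_mono)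
  then show ?thesis using True by (auto simp: Lnorm_def)
next
  case False
  define q where "q = enn2real p"
  have q: "1 \<le> q" using p False exponent_ge_1 q_def by blast
  show ?thesis
  proof (rule ennreal_le_epsilon)
    fix e :: real
    assume fin: "Lnorm M p f + Lnorm M p g < top" and e: "0 < e"
    define a where "a = enn2real (Lnorm M p f) + e / 2"
    define b where "b = enn2real (Lnorm M p g) + e / 2"
    have pos: "0 < a" "0 < b" using e by (auto simp: a_def b_def add_nonneg_pos)
    have lea: "Lnorm M p f \<le> ennreal a" and leb: "Lnorm M p g \<le> ennreal b"
      using fin e by (auto simp: a_def b_def ennreal_plus intro!: add_increasing2)
    have sum: "ennreal (a + b) = Lnorm M p f + Lnorm M p g + ennreal e"
    proof -
      have "ennreal (a + b) = ennreal (enn2real (Lnorm M p f) + enn2real (Lnorm M p g) + e)"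
        by (simp add: a_def b_def ac_simps)
      then show ?thesis using fin e by (simp add: ennreal_plus)
    qed
    define \<mu> where "\<mu> = a / (a + b)"
    define \<nu> where "\<nu> = b / (a + b)"
    have mn: "0 \<le> \<mu>" "0 \<le> \<nu>" "\<mu> + \<nu> = 1"
      using pos by (auto simp: \<mu>_def \<nu>_def add_divide_distrib[symmetric])
    define A where "A = (a + b) powr q * \<mu> * a powr - q"
    define B where "B = (a + b) powr q * \<nu> * b powr - q"
    have AB: "0 \<le> A" "0 \<le> B" using mn by (auto simp: A_def B_def)
    have total: "A * a powr q + B * b powr q = (a + b) powr q"
    proof -
      have "A * a powr q = (a + b) powr q * \<mu>" "B * b powr q = (a + b) powr q * \<nu>"
        using pos by (simp_all add: A_def B_def powr_minus)
      then show ?thesis using mn(3) by (simp add: distrib_left[symmetric])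
    qed
    have real_bound: "(x + y) powr q \<le> A * x powr q + B * y powr q" if "0 \<le> x" "0 \<le> y" for x y
    proof -
      have "(x + y) powr q = (a + b) powr q * (\<mu> * (x / a) + \<nu> * (y / b)) powr q"
      proof -
        have "x + y = (a + b) * (\<mu> * (x / a) + \<nu> * (y / b))"
          using pos by (simp add: \<mu>_def \<nu>_def distrib_left)
        moreover have "0 \<le> \<mu> * (x / a) + \<nu> * (y / b)" using pos that mn by simp
        ultimately show ?thesis using pos by (metis powr_mult)
      qed
      also have "\<dots> \<le> (a + b) powr q * (\<mu> * (x / a) powr q + \<nu> * (y / b) powr q)"
        by (intro mult_left_mono powr_convex_combination) (use pos that mn q in auto)
      also have "\<dots> = A * x powr q + B * y powr q"
        using pos that by (simp add: A_def B_def powr_divide powr_minus field_simps)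
      finally show ?thesis .
    qed
    have Ap: "0 < A" "0 < B" using pos by (auto simp: A_def B_def \<mu>_def \<nu>_def)
    have bound: "epow (x + y) q \<le> ennreal A * epow x q + ennreal B * epow y q" for x y
    proof (cases "x = \<infinity> \<or> y = \<infinity>")
      case True
      then show ?thesis using Ap q by (auto simp: ennreal_mult_top)
    next
      case False
      then obtain u v where uv: "x = ennreal u" "y = ennreal v" "0 \<le> u" "0 \<le> v"
        by (metis ennreal_cases infinity_ennreal_def)
      have "epow (x + y) q = ennreal ((u + v) powr q)"
        using uv by (metis add_nonneg_nonneg ennreal_plus epow_ennreal)
      also have "\<dots> \<le> ennreal (A * u powr q + B * v powr q)"
        by (intro ennreal_leI real_bound uv)
      also have "\<dots> = ennreal A * epow x q + ennreal B * epow y q"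
        using uv AB by (simp add: epow_ennreal ennreal_mult')
      finally show ?thesis .
    qed
    have "Lnorm M p (\<lambda>z. f z + g z) \<le> ennreal (a + b)"
    proof (rule Lnorm_finite_exponent_le[OF p False], unfold q_def[symmetric])
      have "(\<integral>\<^sup>+z. epow (f z + g z) q \<partial>M)
          \<le> (\<integral>\<^sup>+z. ennreal A * epow (f z) q + ennreal B * epow (g z) q \<partial>M)"
        by (intro nn_integral_mono bound)
      also have "\<dots> = ennreal A * (\<integral>\<^sup>+z. epow (f z) q \<partial>M) + ennreal B * (\<integral>\<^sup>+z. epow (g z) q \<partial>M)"
        by (simp add: nn_integral_add nn_integral_cmult)
      also have "\<dots> = ennreal A * epow (Lnorm M p f) q + ennreal B * epow (Lnorm M p g) q"
        using p False by (simp add: epow_Lnorm q_def)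
      also have "\<dots> \<le> ennreal A * epow (ennreal a) q + ennreal B * epow (ennreal b) q"
        by (intro add_mono mult_left_mono epow_mono lea leb) (use q in auto)
      also have "\<dots> = ennreal (A * a powr q + B * b powr q)"
        using pos AB by (simp add: epow_ennreal ennreal_mult')
      also have "\<dots> = epow (ennreal (a + b)) q"
        using pos total by (simp add: epow_ennreal del: ennreal_plus)
      finally show "(\<integral>\<^sup>+z. epow (f z + g z) q \<partial>M) \<le> epow (ennreal (a + b)) q" .
    qed
    then show "Lnorm M p (\<lambda>z. f z + g z) \<le> Lnorm M p f + Lnorm M p g + ennreal e"
      using sum by simp
  qed
qed

lemma Lnorm_0: "1 \<le> p \<Longrightarrow> Lnorm M p (\<lambda>z. 0) = 0"
  using Lnorm_cmult[of p "\<lambda>z. 0" M 0] by simp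

lemma Lnorm_sum:
  assumes p: "1 \<le> p" and "finite I" and meas: "\<And>i. i \<in> I \<Longrightarrow> f i \<in> borel_measurable M"
  shows "Lnorm M p (\<lambda>z. \<Sum>i\<in>I. f i z) \<le> (\<Sum>i\<in>I. Lnorm M p (f i))"
  using assms(2,3)
proof (induction I)
  case empty
  then show ?case using p by (simp add: Lnorm_0)
next
  case (insert i I)
  have "Lnorm M p (\<lambda>z. f i z + (\<Sum>i\<in>I. f i z)) \<le> Lnorm M p (f i) + Lnorm M p (\<lambda>z. \<Sum>i\<in>I. f i z)"
    using insert by (intro Lnorm_triangle p borel_measurable_sum) auto
  also have "\<dots> \<le> Lnorm M p (f i) + (\<Sum>i\<in>I. Lnorm M p (f i))"
    using insert by (intro add_left_mono) auto
  finally show ?case using insert by simp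
qed

text \<open>A convex function lies above its tangent: the tangent of \<open>x powr q\<close> at \<open>a\<close>, in the form of Young's
  inequality.\<close>

lemma powr_tangent:
  assumes "1 \<le> q" "0 < a" "0 \<le> (x :: real)"
  shows "q * a powr (q - 1) * x \<le> x powr q + (q - 1) * a powr q"
proof (cases "x = 0")
  case True
  then show ?thesis using assms by simp
next
  case False
  have "(x powr q) powr (1 / q) * (a powr q) powr (1 - 1 / q)
      \<le> (1 / q) * x powr q + (1 - 1 / q) * a powr q"
    by (rule Youngs_inequality_0) (use assms False in auto)
  moreover have "(x powr q) powr (1 / q) = x" "(a powr q) powr (1 - 1 / q) = a powr (q - 1)"
    using assms by (auto simp: powr_powr algebra_simps)
  ultimately show ?thesis using assms by (simp add: field_simps)
qed

section \<open>A Schur test for transported averages\<close>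

text \<open>Jensen's inequality for a kernel of mass at most \<open>C\<close>: integrate the tangent inequality for
  \<open>x powr q\<close> at the point \<open>a = I / C\<close>, where \<open>I\<close> is the integral on the left.\<close>

lemma nn_integral_kernel_power:
  assumes q: "1 \<le> q" and C: "0 < C"
    and [measurable]: "k \<in> borel_measurable N" "g \<in> borel_measurable N"
    and k: "(\<integral>\<^sup>+t. k t \<partial>N) \<le> ennreal C"
  shows "epow (\<integral>\<^sup>+t. k t * g t \<partial>N) q
    \<le> ennreal (C powr (q - 1)) * (\<integral>\<^sup>+t. k t * epow (g t) q \<partial>N)"
proof (cases "(\<integral>\<^sup>+t. k t * epow (g t) q \<partial>N) = \<infinity>")
  case True
  then show ?thesis using C by (simp add: ennreal_mult_top)
next
  case False
  define I where "I = (\<integral>\<^sup>+t. k t * g t \<partial>N)"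
  define J where "J = (\<integral>\<^sup>+t. k t * epow (g t) q \<partial>N)"
  have le1: "x \<le> 1 + epow x q" for x
  proof (cases x)
    case (real u)
    have "u \<le> 1 + u powr q"
      using real q powr_mono[of 1 q u] by (cases "u \<le> 1") (auto simp: add_increasing2)
    then show ?thesis using real by (simp add: epow_ennreal ennreal_1[symmetric] ennreal_plus[symmetric] ennreal_le_iff del: ennreal_1 ennreal_plus)
  qed (simp add: epow_def)
  have "I \<le> (\<integral>\<^sup>+t. k t + k t * epow (g t) q \<partial>N)"
    unfolding I_def using mult_left_mono[OF le1] by (intro nn_integral_mono) (simp add: distrib_left)
  also have "\<dots> \<le> ennreal C + J"
    using k by (simp add: nn_integral_add J_def)
  also have "\<dots> < \<infinity>" using False by (simp add: J_def less_top)
  finally have "I < \<infinity>" .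
  then obtain i where i: "I = ennreal i" "0 \<le> i" by (cases I) auto
  obtain j where j: "J = ennreal j" "0 \<le> j" using False by (cases J) (auto simp: J_def)
  show ?thesis
  proof (cases "i = 0")
    case True
    then show ?thesis using i I_def by simp
  next
    case False
    with i have ip: "0 < i" by simp
    define a where "a = i / C"
    have a: "0 < a" using ip C by (simp add: a_def)
    have young': "ennreal (q * a powr (q - 1)) * x \<le> epow x q + ennreal ((q - 1) * a powr q)" for x
    proof (cases x)
      case (real u)
      then show ?thesis
        using powr_tangent[OF q a, of u] q
        by (simp add: epow_ennreal ennreal_plus[symmetric] ennreal_mult'[symmetric] ennreal_le_iff
            del: ennreal_plus)
    qed (simp add: epow_def)
    have "ennreal (q * a powr (q - 1)) * I = (\<integral>\<^sup>+t. k t * (ennreal (q * a powr (q - 1)) * g t) \<partial>N)"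
      unfolding I_def by (subst nn_integral_cmult[symmetric]) (auto simp: ac_simps)
    also have "\<dots> \<le> (\<integral>\<^sup>+t. k t * (epow (g t) q + ennreal ((q - 1) * a powr q)) \<partial>N)"
      by (intro nn_integral_mono mult_left_mono young') auto
    also have "\<dots> = J + ennreal ((q - 1) * a powr q) * (\<integral>\<^sup>+t. k t \<partial>N)"
      unfolding J_def distrib_left
      by (subst nn_integral_add) (auto simp: nn_integral_multc mult.commute)
    also have "\<dots> \<le> J + ennreal ((q - 1) * a powr q) * ennreal C"
      by (intro add_left_mono mult_left_mono k) auto
    finally have "q * a powr (q - 1) * i \<le> j + (q - 1) * a powr q * C"
      using i j q C a by (simp add: ennreal_plus[symmetric] ennreal_mult'[symmetric] ennreal_le_iff
          del: ennreal_plus)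
    moreover have "a powr q * C = a powr (q - 1) * i"
    proof -
      have "i = a * C" using C by (simp add: a_def)
      then show ?thesis using a by (simp add: powr_diff)
    qed
    ultimately have "q * (a powr (q - 1) * i) \<le> j + (q - 1) * (a powr (q - 1) * i)"
      by (simp add: mult.assoc)
    then have "a powr (q - 1) * i \<le> j"
      by (simp add: algebra_simps)
    moreover have "i powr q = C powr (q - 1) * (a powr (q - 1) * i)"
      using ip C by (simp add: a_def powr_divide powr_diff)
    ultimately have "i powr q \<le> C powr (q - 1) * j"
      by (simp add: mult_left_mono)
    then show ?thesis
      unfolding I_def[symmetric] J_def[symmetric] using i j
      by (simp add: epow_ennreal ennreal_mult'[symmetric] ennreal_leI)
  qed
qed

text \<open>The operator \<open>T G z = \<integral> k(z, t) G(\<tau>(z, t)) dt\<close> is bounded on \<open>L\<^sup>\<infinity>\<close> by the row bound and on \<open>L\<^sup>1\<close> by the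
  column bound: \<open>k'\<close> is a majorant of the kernel after the change of variables \<open>w = \<tau>(z, t)\<close>. For
  \<open>1 < p < \<infinity>\<close>, Jensen's inequality gives \<open>(T G)\<^sup>p \<le> C\<^sup>p\<^sup>-\<^sup>1 T (G\<^sup>p)\<close>, and the \<open>L\<^sup>1\<close> bound applies to
  \<open>G\<^sup>p\<close>.\<close>

proposition Schur_test:
  fixes k :: "'a \<Rightarrow> 'b \<Rightarrow> ennreal" and k' :: "'a \<Rightarrow> 'b \<Rightarrow> ennreal"
  assumes M: "sigma_finite_measure M" and N: "sigma_finite_measure N"
    and p: "1 \<le> p" and C: "0 < C"
    and k [measurable]: "(\<lambda>(z, t). k z t) \<in> borel_measurable (M \<Otimes>\<^sub>M N)"
    and tau [measurable]: "(\<lambda>(z, t). \<tau> z t) \<in> M \<Otimes>\<^sub>M N \<rightarrow>\<^sub>M M"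
    and k' [measurable]: "(\<lambda>(z, t). k' z t) \<in> borel_measurable (M \<Otimes>\<^sub>M N)"
    and row: "\<And>z. z \<in> space M \<Longrightarrow> (\<integral>\<^sup>+t. k z t \<partial>N) \<le> ennreal C"
    and col: "\<And>w. w \<in> space M \<Longrightarrow> (\<integral>\<^sup>+t. k' w t \<partial>N) \<le> ennreal C"
    and adjoint: "\<And>t G. t \<in> space N \<Longrightarrow> G \<in> borel_measurable M \<Longrightarrow>
      (\<integral>\<^sup>+z. k z t * G (\<tau> z t) \<partial>M) \<le> (\<integral>\<^sup>+w. k' w t * G w \<partial>M)"
    and F [measurable]: "F \<in> borel_measurable M" and G [measurable]: "G \<in> borel_measurable M"
    and le: "\<And>z. z \<in> space M \<Longrightarrow> F z \<le> (\<integral>\<^sup>+t. k z t * G (\<tau> z t) \<partial>N)"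
  shows "Lnorm M p F \<le> ennreal C * Lnorm M p G"
proof -
  interpret M: sigma_finite_measure M by fact
  interpret N: sigma_finite_measure N by fact
  interpret P: pair_sigma_finite M N ..
  have L1: "(\<integral>\<^sup>+z. \<integral>\<^sup>+t. k z t * H (\<tau> z t) \<partial>N \<partial>M) \<le> ennreal C * (\<integral>\<^sup>+w. H w \<partial>M)"
    if [measurable]: "H \<in> borel_measurable M" for H
  proof -
    have "(\<integral>\<^sup>+z. \<integral>\<^sup>+t. k z t * H (\<tau> z t) \<partial>N \<partial>M) = (\<integral>\<^sup>+t. \<integral>\<^sup>+z. k z t * H (\<tau> z t) \<partial>M \<partial>N)"
      by (rule P.Fubini'[symmetric]) measurable
    also have "\<dots> \<le> (\<integral>\<^sup>+t. \<integral>\<^sup>+w. k' w t * H w \<partial>M \<partial>N)"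
      by (intro nn_integral_mono adjoint) auto
    also have "\<dots> = (\<integral>\<^sup>+w. \<integral>\<^sup>+t. k' w t * H w \<partial>N \<partial>M)"
      by (rule P.Fubini') measurable
    also have "\<dots> = (\<integral>\<^sup>+w. (\<integral>\<^sup>+t. k' w t \<partial>N) * H w \<partial>M)"
      by (intro nn_integral_cong nn_integral_multc) measurable
    also have "\<dots> \<le> (\<integral>\<^sup>+w. ennreal C * H w \<partial>M)"
      by (intro nn_integral_mono mult_right_mono col) auto
    also have "\<dots> = ennreal C * (\<integral>\<^sup>+w. H w \<partial>M)"
      by (rule nn_integral_cmult) measurable
    finally show ?thesis .
  qed
  show ?thesis
  proof (cases "p = \<infinity>")
    case True
    define S where "S = esssup M G"
    define B where "B = {w \<in> space M. S < G w}"
    have [measurable]: "B \<in> sets M" by (simp add: B_def)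
    have null: "emeasure M B = 0" unfolding B_def S_def by (rule esssup_zero_measure)
    (* The L1 bound, applied to the indicator of the null set B where G exceeds its essential
       supremum, shows that almost every row of the kernel avoids B. *)
    have "(\<integral>\<^sup>+z. \<integral>\<^sup>+t. k z t * indicator B (\<tau> z t) \<partial>N \<partial>M) \<le> 0"
      using L1[of "indicator B"] null by simp
    then have "AE z in M. (\<integral>\<^sup>+t. k z t * indicator B (\<tau> z t) \<partial>N) = 0"
      by (subst nn_integral_0_iff_AE[symmetric]) (auto intro!: N.borel_measurable_nn_integral)
    then have "AE z in M. F z \<le> ennreal C * S"
    proof (rule AE_mp, intro AE_I2 impI)
      fix z assume z: "z \<in> space M" and 0: "(\<integral>\<^sup>+t. k z t * indicator B (\<tau> z t) \<partial>N) = 0"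
      have tz: "\<tau> z t \<in> space M" if "t \<in> space N" for t
        using measurable_space[OF tau, of "(z, t)"] that z by (simp add: space_pair_measure)
      have "F z \<le> (\<integral>\<^sup>+t. k z t * G (\<tau> z t) \<partial>N)" by (rule le[OF z])
      also have "\<dots> \<le> (\<integral>\<^sup>+t. k z t * S + \<infinity> * (k z t * indicator B (\<tau> z t)) \<partial>N)"
      proof (intro nn_integral_mono)
        fix t assume t: "t \<in> space N"
        show "k z t * G (\<tau> z t) \<le> k z t * S + \<infinity> * (k z t * indicator B (\<tau> z t))"
        proof (cases "\<tau> z t \<in> B")
          case True
          then show ?thesis by (cases "k z t = 0") (auto simp: ennreal_top_mult)
        next
          case False
          then have "G (\<tau> z t) \<le> S" using tz[OF t] by (auto simp: B_def)
          with False show ?thesis by (simp add: mult_left_mono)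
        qed
      qed
      also have "\<dots> = (\<integral>\<^sup>+t. k z t \<partial>N) * S + \<infinity> * (\<integral>\<^sup>+t. k z t * indicator B (\<tau> z t) \<partial>N)"
        using z by (subst nn_integral_add) (auto simp: nn_integral_multc nn_integral_cmult)
      also have "\<dots> \<le> ennreal C * S" using 0 row[OF z] by (simp add: mult_right_mono)
      finally show "F z \<le> ennreal C * S" .
    qed
    then show ?thesis using True by (auto simp: Lnorm_def S_def)
  next
    case False
    define q where "q = enn2real p"
    have q: "1 \<le> q" using p False exponent_ge_1 q_def by blast
    show ?thesis
    proof (rule Lnorm_finite_exponent_le[OF p False], unfold q_def[symmetric])
      have "(\<integral>\<^sup>+z. epow (F z) q \<partial>M)
          \<le> (\<integral>\<^sup>+z. ennreal (C powr (q - 1)) * (\<integral>\<^sup>+t. k z t * epow (G (\<tau> z t)) q \<partial>N) \<partial>M)"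
      proof (intro nn_integral_mono)
        fix z assume z: "z \<in> space M"
        have "epow (F z) q \<le> epow (\<integral>\<^sup>+t. k z t * G (\<tau> z t) \<partial>N) q"
          using q by (intro epow_mono le z) auto
        also have "\<dots> \<le> ennreal (C powr (q - 1)) * (\<integral>\<^sup>+t. k z t * epow (G (\<tau> z t)) q \<partial>N)"
          using z by (intro nn_integral_kernel_power q C row) measurable
        finally show "epow (F z) q \<le> ennreal (C powr (q - 1)) * (\<integral>\<^sup>+t. k z t * epow (G (\<tau> z t)) q \<partial>N)" .
      qed
      also have "\<dots> = ennreal (C powr (q - 1)) * (\<integral>\<^sup>+z. \<integral>\<^sup>+t. k z t * epow (G (\<tau> z t)) q \<partial>N \<partial>M)"
        by (rule nn_integral_cmult) measurable
      also have "\<dots> \<le> ennreal (C powr (q - 1)) * (ennreal C * (\<integral>\<^sup>+w. epow (G w) q \<partial>M))"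
        by (intro mult_left_mono L1) auto
      also have "\<dots> = epow (ennreal C) q * epow (Lnorm M p G) q"
        using C p False by (simp add: epow_ennreal epow_Lnorm q_def powr_diff ennreal_mult'[symmetric]
            mult.assoc[symmetric])
      also have "\<dots> = epow (ennreal C * Lnorm M p G) q"
        using q by (simp add: epow_mult)
      finally show "(\<integral>\<^sup>+z. epow (F z) q \<partial>M) \<le> epow (ennreal C * Lnorm M p G) q" .
    qed
  qed
qed

section \<open>Cauchy integrals and partial derivatives of entire functions\<close>

definition turn :: "real \<Rightarrow> complex" where
  "turn \<theta> = exp (2 * of_real pi * \<i> * of_real \<theta>)"

lemma norm_turn [simp]: "norm (turn \<theta>) = 1"
  by (simp add: turn_def norm_exp_eq_Re)

lemma turn_nonzero [simp]: "turn \<theta> \<noteq> 0"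
  by (simp add: turn_def)

lemma continuous_on_turn [continuous_intros]:
  "continuous_on S g \<Longrightarrow> continuous_on S (\<lambda>x. turn (g x))"
  unfolding turn_def by (intro continuous_intros)

text \<open>The circle is parametrised over \<open>[0, 1]\<close>, so that contour integrals become averages over a probability
  measure and no factor \<open>2 \<pi>\<close> survives.\<close>

lemma circle_has_contour_integral:
  fixes s :: real
  assumes "(g has_contour_integral 2 * of_real pi * \<i> * I) (circlepath w s)"
  shows "((\<lambda>\<theta>. g (w + s * turn \<theta>) * (s * turn \<theta>)) has_integral I) {0..1}"
proof -
  have "((\<lambda>\<theta>. g (circlepath w s \<theta>) * (2 * pi * \<i> * s * turn \<theta>)) has_integral 2 * of_real pi * \<i> * I) {0..1}"
    using assms unfolding has_contour_integral_def
    by (rule has_integral_eq[rotated]) (simp add: vector_derivative_circlepath01 turn_def)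
  from has_integral_mult_right[OF this, of "1 / (2 * of_real pi * \<i>)"]
  show ?thesis by (simp add: circlepath turn_def field_simps)
qed

lemma holomorphic_circle_mean:
  fixes s :: real
  assumes "h holomorphic_on UNIV" "0 < s"
  shows "((\<lambda>\<theta>. h (w + s * turn \<theta>)) has_integral h w) {0..1}"
proof -
  have "((\<lambda>u. h u / (u - w)) has_contour_integral 2 * of_real pi * \<i> * h w) (circlepath w s)"
    using assms by (intro Cauchy_integral_circlepath holomorphic_on_imp_continuous_on)
      (auto intro: holomorphic_on_subset)
  from circle_has_contour_integral[OF this] show ?thesis
    using assms by (simp add: field_simps)
qed

lemma holomorphic_circle_deriv:
  fixes s :: real
  assumes "h holomorphic_on UNIV" "0 < s"
  shows "((\<lambda>\<theta>. h (w + s * turn \<theta>) / (s * turn \<theta>)) has_integral deriv h w) {0..1}"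
proof -
  have "continuous_on (cball w s) h" "h holomorphic_on ball w s"
    using assms by (auto intro: holomorphic_on_subset holomorphic_on_imp_continuous_on)
  from Cauchy_has_contour_integral_higher_derivative_circlepath[OF this, of w 1] assms
  have "((\<lambda>u. h u / (u - w) ^ 2) has_contour_integral 2 * of_real pi * \<i> * deriv h w) (circlepath w s)"
    by (simp add: numeral_2_eq_2)
  from circle_has_contour_integral[OF this] show ?thesis
    using assms by (simp add: field_simps power2_eq_square)
qed

lemma axis_eq_smult: "axis j w = w *s axis j (1 :: 'a :: semiring_1)"
  by (simp add: vec_eq_iff axis_def)

lemma bounded_linear_smult_left: "bounded_linear (\<lambda>w. w *s (v :: complex ^ 'n))"
  by (rule linear_conv_bounded_linear[THEN iffD1], rule linearI)
     (simp_all add: vec_eq_iff algebra_simps)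

lemma bounded_linear_axis: "bounded_linear (axis j :: complex \<Rightarrow> complex ^ 'n)"
  using bounded_linear_smult_left[of "axis j 1"] by (subst axis_eq_smult[abs_def]) 

lemmas continuous_on_axis [continuous_intros] = bounded_linear.continuous_on[OF bounded_linear_axis]

lemma norm_axis_complex [simp]: "norm (axis j (w :: complex) :: complex ^ 'n) = norm w"
proof -
  have "(\<Sum>i\<in>UNIV. (norm ((axis j w :: complex ^ 'n) $ i))\<^sup>2) = (\<Sum>i\<in>UNIV. if i = j then (norm w)\<^sup>2 else 0)"
    by (intro sum.cong) (auto simp: axis_def)
  then show ?thesis by (simp add: norm_vec_def L2_set_def)
qed

lemma norm_smult_complex [simp]: "norm (w *s v) = norm (w :: complex) * norm (v :: complex ^ 'n)"
  unfolding norm_vec_def by (simp add: norm_mult L2_set_right_distrib)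

lemma entire_slice_has_derivative:
  fixes f :: "complex ^ 'n \<Rightarrow> complex"
  assumes "(f has_derivative D) (at (z + w *s v))" "\<And>c v. D (c *s v) = c * D v"
  shows "((\<lambda>w. f (z + w *s v)) has_field_derivative D v) (at w)"
proof -
  have "((\<lambda>w. z + w *s v) has_derivative (\<lambda>h. h *s v)) (at w)"
    using has_derivative_add[OF has_derivative_const[of z]
        bounded_linear.has_derivative[OF bounded_linear_smult_left[of v] has_derivative_ident], of "at w"]
    by simp
  from has_derivative_compose[OF this assms(1)]
  show ?thesis by (simp add: assms(2) has_field_derivative_def mult_commute_abs)
qed

lemma holomorphic_slice:
  fixes f :: "complex ^ 'n \<Rightarrow> complex"
  assumes "entire f"
  shows "(\<lambda>w. f (z + w *s v)) holomorphic_on UNIV"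
proof (rule holomorphic_onI)
  fix w
  obtain D where "(f has_derivative D) (at (z + w *s v))" "\<And>c v. D (c *s v) = c * D v"
    using assms unfolding entire_def by blast
  from entire_slice_has_derivative[OF this]
  show "(\<lambda>w. f (z + w *s v)) field_differentiable at w"
    unfolding field_differentiable_def by blast
qed

lemma entire_has_derivative:
  fixes f :: "complex ^ 'n \<Rightarrow> complex"
  assumes "entire f"
  shows "(f has_derivative (\<lambda>v. \<Sum>j\<in>UNIV. v $ j * partial j f z)) (at z)"
proof -
  obtain D where D: "(f has_derivative D) (at z)" "\<And>c v. D (c *s v) = c * D v"
    using assms unfolding entire_def by blast
  interpret bounded_linear D using D(1) by (rule has_derivative_bounded_linear)
  have partial_eq: "partial j f z = D (axis j 1)" for j
  proof -
    have "((\<lambda>w. f (z + w *s axis j 1)) has_field_derivative D (axis j 1)) (at 0)"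
      using D by (intro entire_slice_has_derivative) auto
    then show ?thesis unfolding partial_def by (subst axis_eq_smult) (rule DERIV_imp_deriv)
  qed
  have "D v = (\<Sum>j\<in>UNIV. v $ j * D (axis j 1))" for v
  proof -
    have "D v = D (\<Sum>j\<in>UNIV. v $ j *s axis j 1)" by (simp only: basis_expansion)
    also have "\<dots> = (\<Sum>j\<in>UNIV. D (v $ j *s axis j 1))" by (rule sum)
    finally show ?thesis by (simp only: D(2))
  qed
  then have "D = (\<lambda>v. \<Sum>j\<in>UNIV. v $ j * partial j f z)"
    unfolding partial_eq by (rule ext)
  with D(1) show ?thesis by simp
qed

lemma continuous_on_entire:
  assumes "entire f" shows "continuous_on S f"
  using has_derivative_continuous[OF entire_has_derivative[OF assms]]
  by (simp add: continuous_at_imp_continuous_on)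

lemma partial_circle_integral:
  fixes s :: real
  assumes "entire f" "0 < s"
  shows "((\<lambda>\<theta>. f (z + axis j (s * turn \<theta>)) / (s * turn \<theta>)) has_integral partial j f z) {0..1}"
  using holomorphic_circle_deriv[OF holomorphic_slice[OF assms(1), of z "axis j 1"] assms(2), of 0]
  unfolding partial_def by (simp flip: axis_eq_smult)

text \<open>On a circle of fixed radius the integrand depends on \<open>z\<close> through \<open>f\<close> alone. Continuity,
  differentiability and commutation of the partial derivatives are read off from this formula.\<close>

lemma partial_unit_circle:
  assumes "entire f"
  shows "partial j f z = integral (cbox 0 1) (\<lambda>\<theta>. f (z + axis j (turn \<theta>)) / turn \<theta>)"
  using partial_circle_integral[OF assms, of 1 z j] by (simp add: integral_unique)

lemma continuous_on_partial:
  assumes "entire f" shows "continuous_on S (partial j f)"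
proof -
  have "continuous_on UNIV (\<lambda>z. integral (cbox 0 1) (\<lambda>\<theta>. f (z + axis j (turn \<theta>)) / turn \<theta>))"
    by (rule integral_continuous_on_param)
       (auto simp: split_beta intro!: continuous_intros continuous_on_compose2[OF continuous_on_entire[OF assms, of UNIV]])
  then show ?thesis
    unfolding partial_unit_circle[OF assms, abs_def] by (rule continuous_on_subset) simp
qed

text \<open>Differentiation under the integral sign. The continuity of the derivative of \<open>f\<close> that it requires is
  \<open>continuous_on_partial\<close>; the resulting derivative is complex linear because every \<open>D z \<theta>\<close> is.\<close>

lemma entire_partial:
  fixes f :: "complex ^ 'n \<Rightarrow> complex"
  assumes "entire f"
  shows "entire (partial j f)"
proof -
  define coord :: "'n \<Rightarrow> (complex ^ 'n) \<Rightarrow>\<^sub>L complex" where "coord = (\<lambda>i. Blinfun (\<lambda>v. v $ i))"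
  have coord: "blinfun_apply (coord i) v = v $ i" for i v
    unfolding coord_def by (simp add: bounded_linear_Blinfun_apply bounded_linear_vec_nth)
  define D where "D = (\<lambda>z \<theta>. \<Sum>i\<in>UNIV.
    blinfun_mult_right (partial i f (z + axis j (turn \<theta>)) / turn \<theta>) o\<^sub>L coord i)"
  have D_apply: "blinfun_apply (D z \<theta>) v = (\<Sum>i\<in>UNIV. v $ i * partial i f (z + axis j (turn \<theta>))) / turn \<theta>" for z \<theta> v
    unfolding D_def by (simp add: blinfun.sum_left coord sum_divide_distrib field_simps)
  have contD: "continuous_on (UNIV \<times> cbox 0 1) (\<lambda>(z, \<theta>). D z \<theta>)"
    unfolding D_def split_beta
    by (intro continuous_intros continuous_on_compose2[OF continuous_on_partial[OF assms, of UNIV]]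
        bounded_linear.continuous_on[OF bounded_linear_blinfun_mult_right]) auto
  have contDz: "continuous_on (cbox 0 1) (D z)" for z
  proof -
    have "continuous_on (cbox 0 1) (\<lambda>\<theta>. case (z, \<theta>) of (z, \<theta>) \<Rightarrow> D z \<theta>)"
      by (rule continuous_on_compose2[OF contD]) (auto intro!: continuous_intros)
    then show ?thesis by simp
  qed
  have "((\<lambda>z. integral (cbox 0 1) (\<lambda>\<theta>. f (z + axis j (turn \<theta>)) / turn \<theta>))
      has_derivative blinfun_apply (integral (cbox 0 1) (D z))) (at z within UNIV)" for z
  proof (rule leibniz_rule[OF _ _ contD])
    fix x \<theta>
    have "((\<lambda>x. f (x + axis j (turn \<theta>))) has_derivative
        (\<lambda>v. \<Sum>i\<in>UNIV. v $ i * partial i f (x + axis j (turn \<theta>)))) (at x)"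
      by (rule has_derivative_compose[OF _ entire_has_derivative[OF assms], where f = "\<lambda>x. x + axis j (turn \<theta>)", 
          of "\<lambda>x. x", simplified])
         (auto intro!: derivative_eq_intros)
    from has_derivative_divide[OF this has_derivative_const, of "turn \<theta>"]
    show "((\<lambda>x. f (x + axis j (turn \<theta>)) / turn \<theta>) has_derivative blinfun_apply (D x \<theta>)) (at x within UNIV)"
      by (simp add: D_apply[abs_def] field_simps)
  next
    fix x
    show "(\<lambda>\<theta>. f (x + axis j (turn \<theta>)) / turn \<theta>) integrable_on cbox 0 1"
      by (intro integrable_continuous continuous_intros
          continuous_on_compose2[OF continuous_on_entire[OF assms, of UNIV]]) auto
  qed auto
  then have der: "(partial j f has_derivative blinfun_apply (integral (cbox 0 1) (D z))) (at z)" for z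
    unfolding partial_unit_circle[OF assms, abs_def] by simp
  have "blinfun_apply (integral (cbox 0 1) (D z)) (c *s v) = c * blinfun_apply (integral (cbox 0 1) (D z)) v" for z c v
  proof -
    have app: "blinfun_apply (integral (cbox 0 1) (D z)) u = integral (cbox 0 1) (\<lambda>\<theta>. blinfun_apply (D z \<theta>) u)" for u
      using integral_linear[OF integrable_continuous[OF contDz] blinfun.bounded_linear_left[of u], of z]
      by (simp add: o_def)
    have "blinfun_apply (D z \<theta>) (c *s v) = c * blinfun_apply (D z \<theta>) v" for \<theta>
      by (simp add: D_apply sum_distrib_left mult.assoc)
    then show ?thesis unfolding app by (simp add: integral_mult_right)
  qed
  with der show ?thesis unfolding entire_def by blast
qed

text \<open>Both mixed derivatives are the same double Cauchy integral, up to the order of integration.\<close>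

lemma partial_commute:
  assumes "entire f"
  shows "partial i (partial j f) = partial j (partial i f)"
proof
  fix z
  let ?g = "\<lambda>\<theta> \<phi>. f (z + axis i (turn \<theta>) + axis j (turn \<phi>)) / turn \<phi> / turn \<theta>"
  have double: "partial i (partial j f) z = integral (cbox 0 1) (\<lambda>\<theta>. integral (cbox 0 1)
      (\<lambda>\<phi>. f (z + axis i (turn \<theta>) + axis j (turn \<phi>)) / turn \<phi> / turn \<theta>))" for i j
    by (simp only: partial_unit_circle[OF entire_partial[OF assms]] partial_unit_circle[OF assms]
        integral_divide)
  have "continuous_on (cbox (0, 0) (1, 1)) (\<lambda>(\<theta>, \<phi>). ?g \<theta> \<phi>)"
    unfolding split_beta
    by (intro continuous_intros continuous_on_compose2[OF continuous_on_entire[OF assms, of UNIV]]) auto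
  from integral_swap_continuous[OF this]
  show "partial i (partial j f) z = partial j (partial i f) z"
    unfolding double by (simp add: ac_simps)
qed

lemma entire_funpow_partial: "entire f \<Longrightarrow> entire ((partial j ^^ n) f)"
  by (induction n) (auto intro: entire_partial)

lemma partial_funpow_commute:
  "entire f \<Longrightarrow> partial i ((partial j ^^ n) f) = (partial j ^^ n) (partial i f)"
proof (induction n)
  case (Suc n)
  then show ?case
    using partial_commute[OF entire_funpow_partial[of f n j], of i j] by simp
qed simp

lemma entire_foldr_partial: "entire f \<Longrightarrow> entire (foldr (\<lambda>j. partial j ^^ \<nu> j) js f)"
  by (induction js) (auto intro: entire_funpow_partial)

lemma entire_mpartial: "entire f \<Longrightarrow> entire (mpartial \<nu> f)"
  unfolding mpartial_def by (rule entire_foldr_partial)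

lemma mpartial_zero: "mpartial (\<lambda>_. 0) f = f"
proof -
  have "foldr (\<lambda>j. partial j ^^ 0) js f = f" for js by (induction js) auto
  then show ?thesis by (simp add: mpartial_def)
qed

text \<open>The new derivative is moved past the others to its place in the enumeration \<^const>\<open>coordinates\<close>.\<close>

lemma partial_mpartial:
  assumes "entire f"
  shows "partial i (mpartial \<nu> f) = mpartial (\<nu>(i := Suc (\<nu> i))) f"
proof -
  let ?F = "\<lambda>\<nu> js. foldr (\<lambda>j. partial j ^^ \<nu> j) js f"
  have off: "?F (\<nu>(i := Suc (\<nu> i))) js = ?F \<nu> js" if "i \<notin> set js" for js
    using that by (induction js) auto
  have on: "distinct js \<Longrightarrow> i \<in> set js \<Longrightarrow> ?F (\<nu>(i := Suc (\<nu> i))) js = partial i (?F \<nu> js)" for js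
  proof (induction js)
    case (Cons j js)
    show ?case
    proof (cases "i = j")
      case True
      then show ?thesis using Cons off[of js] by simp
    next
      case False
      then show ?thesis using Cons partial_funpow_commute[OF entire_foldr_partial[OF assms]] by simp
    qed
  qed simp
  show ?thesis
    unfolding mpartial_def using on[OF distinct_coordinates] by (simp add: set_coordinates)
qed

lemma mpartial_Suc_decompose:
  fixes \<nu> :: "'n::finite \<Rightarrow> nat" and f :: "complex ^ 'n \<Rightarrow> complex"
  assumes "entire f" "sum \<nu> UNIV = Suc m"
  obtains i \<mu> where "sum \<mu> UNIV = m" "mpartial \<nu> f = partial i (mpartial \<mu> f)"
proof -
  obtain i where i: "\<nu> i \<noteq> 0"
    using assms(2) by (metis Zero_neq_Suc sum.neutral)
  define \<mu> where "\<mu> = \<nu>(i := \<nu> i - 1)"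
  have nu: "\<nu> = \<mu>(i := Suc (\<mu> i))" using i by (auto simp: \<mu>_def)
  have "sum \<nu> UNIV = \<nu> i + sum \<nu> (UNIV - {i})" by (simp add: sum.remove)
  moreover have "sum \<mu> UNIV = \<mu> i + sum \<mu> (UNIV - {i})" by (simp add: sum.remove)
  moreover have "sum \<mu> (UNIV - {i}) = sum \<nu> (UNIV - {i})" by (rule sum.cong) (auto simp: \<mu>_def)
  ultimately have "sum \<mu> UNIV = m" using assms(2) i by (simp add: \<mu>_def)
  moreover have "mpartial \<nu> f = partial i (mpartial \<mu> f)"
    unfolding partial_mpartial[OF assms(1)] using nu by simp
  ultimately show ?thesis by (rule that)
qed

lemma sum_fun_upd_Suc: "sum (\<mu>(i := Suc (\<mu> i))) UNIV = Suc (sum \<mu> (UNIV :: 'n::finite set))"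
proof -
  have "sum (\<mu>(i := Suc (\<mu> i))) (UNIV - {i}) = sum \<mu> (UNIV - {i})" by (rule sum.cong) auto
  then show ?thesis by (simp add: sum.remove[of UNIV i])
qed

lemma finite_multi_indices: "finite {\<nu> :: 'n::finite \<Rightarrow> nat. sum \<nu> UNIV = m}"
proof (rule finite_subset)
  show "{\<nu> :: 'n \<Rightarrow> nat. sum \<nu> UNIV = m} \<subseteq> UNIV \<rightarrow>\<^sub>E {..m}"
    by (auto simp: PiE_def intro!: member_le_sum)
qed (auto intro: finite_PiE)

lemma nabla_abs_0: "nabla_abs 0 f z = norm (f z)"
proof -
  have "{\<nu> :: 'a \<Rightarrow> nat. sum \<nu> UNIV = 0} = {\<lambda>_. 0}" by auto
  then show ?thesis by (simp add: nabla_abs_def mpartial_zero)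
qed

section \<open>Invariance of Lebesgue measure and the mean value property on balls\<close>

lemma nn_integral_lborel_translate:
  fixes f :: "'a::euclidean_space \<Rightarrow> ennreal"
  assumes [measurable]: "f \<in> borel_measurable borel"
  shows "(\<integral>\<^sup>+x. f (a + x) \<partial>lborel) = (\<integral>\<^sup>+x. f x \<partial>lborel)"
proof -
  have "(\<integral>\<^sup>+x. f x \<partial>lborel) = (\<integral>\<^sup>+x. f x \<partial>distr lborel borel ((+) a))"
    by (simp add: lborel_distr_plus)
  also have "\<dots> = (\<integral>\<^sup>+x. f (a + x) \<partial>lborel)"
    by (rule nn_integral_distr) auto
  finally show ?thesis by simp
qed

lemma nn_integral_lborel_scale:
  fixes f :: "'a::euclidean_space \<Rightarrow> ennreal"
  assumes [measurable]: "f \<in> borel_measurable borel" and "0 < t"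
  shows "(\<integral>\<^sup>+x. f x \<partial>lborel) = ennreal (t ^ DIM('a)) * (\<integral>\<^sup>+x. f (t *\<^sub>R x) \<partial>lborel)"
proof -
  have "(\<integral>\<^sup>+x. f x \<partial>lborel)
      = (\<integral>\<^sup>+x. f x \<partial>density (distr lborel borel (\<lambda>x. 0 + t *\<^sub>R x)) (\<lambda>_. ennreal (\<bar>t\<bar> ^ DIM('a))))"
    using lborel_affine[of t "0 :: 'a"] \<open>0 < t\<close> by simp
  also have "\<dots> = ennreal (t ^ DIM('a)) * (\<integral>\<^sup>+x. f (t *\<^sub>R x) \<partial>lborel)"
    using \<open>0 < t\<close> by (simp add: nn_integral_density nn_integral_distr nn_integral_cmult)
  finally show ?thesis .
qed

lemma emeasure_unit_ball:
  "0 < emeasure lborel (ball (0 :: 'a::euclidean_space) 1)" "emeasure lborel (ball (0 :: 'a::euclidean_space) 1) < \<infinity>"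
  by (simp_all add: emeasure_ball)

text \<open>The uniqueness argument for Haar measure. Both \<open>g \<mapsto> \<integral> g\<close> and \<open>g \<mapsto> \<integral> g(T x) dx\<close> are invariant under
  translations, hence proportional, as Fubini's theorem shows for \<open>g(T x) b(y - T x)\<close>; they agree on the
  indicator \<open>b\<close> of the unit ball, which \<open>T\<close> preserves.\<close>

lemma nn_integral_lborel_isometry:
  fixes T :: "'a::euclidean_space \<Rightarrow> 'a"
  assumes T: "linear T" "\<And>x. norm (T x) = norm x" "surj T"
    and [measurable]: "g \<in> borel_measurable borel"
  shows "(\<integral>\<^sup>+x. g (T x) \<partial>lborel) = (\<integral>\<^sup>+x. g x \<partial>lborel)"
proof -
  interpret T: linear T by fact
  have cont: "continuous_on S T" for S by (rule linear_continuous_on) (simp add: T linear_linear linear_conv_bounded_linear[symmetric])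
  have [measurable]: "T \<in> borel_measurable borel"
    by (intro borel_measurable_continuous_onI cont)
  have TT: "T (inv T y) = y" for y using T(3) by (simp add: surj_f_inv_f)
  define b :: "'a \<Rightarrow> ennreal" where "b = indicator (ball 0 1)"
  have [measurable]: "b \<in> borel_measurable borel"
    unfolding b_def by (intro borel_measurable_indicator) simp
  define V where "V = (\<integral>\<^sup>+y. b y \<partial>lborel)"
  have V: "0 < V" "V < \<infinity>" using emeasure_unit_ball[where 'a='a] by (simp_all add: V_def b_def)
  have "V * (\<integral>\<^sup>+x. g (T x) \<partial>lborel) = (\<integral>\<^sup>+x. g (T x) * V \<partial>lborel)"
    by (subst nn_integral_multc) (simp_all add: mult.commute)
  also have "\<dots> = (\<integral>\<^sup>+x. \<integral>\<^sup>+y. g (T x) * b (- T x + y) \<partial>lborel \<partial>lborel)"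
    using nn_integral_lborel_translate[of b "- T x" for x]
    by (intro nn_integral_cong) (subst nn_integral_cmult, simp_all add: V_def)
  also have "\<dots> = (\<integral>\<^sup>+y. \<integral>\<^sup>+x. g (T x) * b (- T x + y) \<partial>lborel \<partial>lborel)"
    by (rule lborel_pair.Fubini'[symmetric]) measurable
  also have "\<dots> = (\<integral>\<^sup>+y. \<integral>\<^sup>+x. g (T (inv T y + x)) * b (- T (inv T y + x) + y) \<partial>lborel \<partial>lborel)"
  proof (rule nn_integral_cong)
    fix y
    have "(\<lambda>x. g (T x) * b (- T x + y)) \<in> borel_measurable borel" by measurable
    from nn_integral_lborel_translate[OF this, of "inv T y"]
    show "(\<integral>\<^sup>+x. g (T x) * b (- T x + y) \<partial>lborel)
      = (\<integral>\<^sup>+x. g (T (inv T y + x)) * b (- T (inv T y + x) + y) \<partial>lborel)" by simp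
  qed
  also have "\<dots> = (\<integral>\<^sup>+y. \<integral>\<^sup>+x. g (T x + y) * b x \<partial>lborel \<partial>lborel)"
    by (simp add: T.add TT b_def indicator_def T(2) add.commute)
  also have "\<dots> = (\<integral>\<^sup>+x. \<integral>\<^sup>+y. g (T x + y) * b x \<partial>lborel \<partial>lborel)"
    by (rule lborel_pair.Fubini') measurable
  also have "\<dots> = V * (\<integral>\<^sup>+x. g x \<partial>lborel)"
    by (simp add: nn_integral_multc nn_integral_lborel_translate nn_integral_cmult V_def mult.commute)
  finally show ?thesis using V by (auto simp: ennreal_mult_cancel_left)
qed

lemma continuous_on_smult_complex [continuous_intros]:
  fixes g :: "'a::topological_space \<Rightarrow> complex ^ 'n"
  assumes "continuous_on S f" "continuous_on S g"
  shows "continuous_on S (\<lambda>x. f x *s g x)"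
  unfolding vector_scalar_mult_def using assms by (intro continuous_intros)

lemma nn_integral_lborel_turn:
  fixes g :: "complex ^ 'n \<Rightarrow> ennreal"
  assumes "g \<in> borel_measurable borel"
  shows "(\<integral>\<^sup>+\<zeta>. g (turn \<theta> *s \<zeta>) \<partial>lborel) = (\<integral>\<^sup>+\<zeta>. g \<zeta> \<partial>lborel)"
proof (rule nn_integral_lborel_isometry[OF _ _ _ assms])
  show "linear ((*s) (turn \<theta>) :: complex ^ 'n \<Rightarrow> complex ^ 'n)"
    by (rule linearI) (simp_all add: vec_eq_iff algebra_simps)
  show "surj ((*s) (turn \<theta>) :: complex ^ 'n \<Rightarrow> complex ^ 'n)"
    by (rule surjI[of _ "\<lambda>v. (1 / turn \<theta>) *s v"]) (simp add: vector_smult_assoc)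
qed simp

text \<open>The passage from Henstock-Kurzweil integrals, in which the Cauchy formulas are stated, to the
  Lebesgue integrals over \<open>[0, \<infinity>]\<close> of the norm estimates.\<close>

lemma norm_has_integral_le_nn_integral:
  fixes g :: "real \<Rightarrow> 'b::euclidean_space"
  assumes "(g has_integral I) {0..1}" "continuous_on {0..1} g"
  shows "ennreal (norm I) \<le> (\<integral>\<^sup>+\<theta>. indicator {0..1} \<theta> * ennreal (norm (g \<theta>)) \<partial>lborel)"
proof -
  have int: "set_integrable lborel {0..1} g"
    using assms(2) by (rule borel_integrable_atLeastAtMost')
  have "I = (LINT \<theta>:{0..1}|lborel. g \<theta>)"
    using set_borel_integral_eq_integral(2)[OF int] assms(1) by (simp add: integral_unique)
  also have "ennreal (norm \<dots>) \<le> (\<integral>\<^sup>+\<theta>. norm (indicator {0..1} \<theta> *\<^sub>R g \<theta>) \<partial>lborel)"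
    unfolding set_lebesgue_integral_def
    using int by (intro integral_norm_bound_ennreal) (simp add: set_integrable_def)
  also have "\<dots> = (\<integral>\<^sup>+\<theta>. indicator {0..1} \<theta> * ennreal (norm (g \<theta>)) \<partial>lborel)"
    by (intro nn_integral_cong) (auto simp: indicator_def)
  finally show ?thesis .
qed

lemma entire_le_circle_mean:
  fixes h :: "complex ^ 'n \<Rightarrow> complex"
  assumes "entire h"
  shows "ennreal (norm (h z)) \<le> (\<integral>\<^sup>+\<theta>. indicator {0..1} \<theta> * ennreal (norm (h (z + turn \<theta> *s \<zeta>))) \<partial>lborel)"
  using holomorphic_circle_mean[OF holomorphic_slice[OF assms, of z \<zeta>], of 1 0]
  by (intro norm_has_integral_le_nn_integral continuous_intros
      continuous_on_compose2[OF continuous_on_entire[OF assms, of UNIV]]) auto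

lemma partial_le_circle_mean:
  fixes f :: "complex ^ 'n \<Rightarrow> complex"
  assumes "entire f" "0 < s"
  shows "ennreal (norm (partial j f z))
    \<le> ennreal (1 / s) * (\<integral>\<^sup>+\<theta>. indicator {0..1} \<theta> * ennreal (norm (f (z + axis j (s * turn \<theta>)))) \<partial>lborel)"
proof -
  have [measurable]: "(\<lambda>\<theta>. f (z + axis j (s * turn \<theta>))) \<in> borel_measurable borel"
    by (intro borel_measurable_continuous_onI continuous_intros
      continuous_on_compose2[OF continuous_on_entire[OF assms(1), of UNIV]]) auto
  have "ennreal (norm (partial j f z))
    \<le> (\<integral>\<^sup>+\<theta>. indicator {0..1} \<theta> * ennreal (norm (f (z + axis j (s * turn \<theta>)) / (s * turn \<theta>))) \<partial>lborel)"
    by (intro norm_has_integral_le_nn_integral partial_circle_integral assms continuous_intros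
      continuous_on_compose2[OF continuous_on_entire[OF assms(1), of UNIV]]) (use assms in auto)
  also have "\<dots> = (\<integral>\<^sup>+\<theta>. ennreal (1 / s) * (indicator {0..1} \<theta> * ennreal (norm (f (z + axis j (s * turn \<theta>))))) \<partial>lborel)"
    using assms(2) by (intro nn_integral_cong)
      (auto simp: indicator_def norm_divide norm_mult ennreal_mult'[symmetric])
  also have "\<dots> = ennreal (1 / s) * (\<integral>\<^sup>+\<theta>. indicator {0..1} \<theta> * ennreal (norm (f (z + axis j (s * turn \<theta>)))) \<partial>lborel)"
    by (rule nn_integral_cmult) measurable
  finally show ?thesis .
qed

lemma entire_measurable_compose:
  fixes f :: "complex ^ 'n \<Rightarrow> complex"
  assumes "entire f" "continuous_on UNIV g"
  shows "(\<lambda>x. f (g x)) \<in> borel_measurable borel"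
  using assms by (intro borel_measurable_continuous_onI continuous_on_compose2[OF continuous_on_entire[OF assms(1), of UNIV]]) auto

text \<open>The mean value property on the circles \<open>z + e\<^sup>i\<^sup>\<theta> \<zeta>\<close>, averaged over \<open>\<zeta>\<close> in the unit ball. For fixed \<open>\<theta>\<close> the
  integral over \<open>\<zeta>\<close> does not depend on \<open>\<theta>\<close>, since \<open>\<zeta> \<mapsto> e\<^sup>i\<^sup>\<theta> \<zeta>\<close> preserves Lebesgue measure and the ball.\<close>

lemma entire_ball_mean:
  fixes h :: "complex ^ 'n \<Rightarrow> complex"
  assumes "entire h"
  shows "emeasure lborel (ball (0 :: complex ^ 'n) 1) * ennreal (norm (h z))
    \<le> (\<integral>\<^sup>+\<zeta>. indicator (ball 0 1) \<zeta> * ennreal (norm (h (z + \<zeta>))) \<partial>lborel)"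
proof -
  define G where "G = (\<lambda>\<zeta>. indicator (ball 0 1) \<zeta> * ennreal (norm (h (z + \<zeta>))))"
  have [measurable]: "h \<in> borel_measurable borel" "ball (0 :: complex ^ 'n) 1 \<in> sets borel"
    using entire_measurable_compose[OF assms, of "\<lambda>x. x"] by simp_all
  have Gm [measurable]: "G \<in> borel_measurable borel" unfolding G_def by measurable
  have "(\<lambda>(\<zeta> :: complex ^ 'n, \<theta>). turn \<theta> *s \<zeta>) \<in> borel_measurable borel"
    unfolding split_beta by (intro borel_measurable_continuous_onI continuous_intros)
  then have [measurable]: "(\<lambda>(\<zeta> :: complex ^ 'n, \<theta>). turn \<theta> *s \<zeta>) \<in> borel_measurable (lborel \<Otimes>\<^sub>M lborel)"
    by (simp add: lborel_prod)
  have "emeasure lborel (ball (0 :: complex ^ 'n) 1) * ennreal (norm (h z))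
      = (\<integral>\<^sup>+\<zeta>. indicator (ball 0 1 :: (complex ^ 'n) set) \<zeta> * ennreal (norm (h z)) \<partial>lborel)"
    by (simp add: nn_integral_multc)
  also have "\<dots> \<le> (\<integral>\<^sup>+\<zeta>. \<integral>\<^sup>+\<theta>. indicator {0..1} \<theta> * G (turn \<theta> *s \<zeta>) \<partial>lborel \<partial>lborel)"
  proof (intro nn_integral_mono)
    fix \<zeta> :: "complex ^ 'n"
    show "indicator (ball 0 1) \<zeta> * ennreal (norm (h z)) \<le> (\<integral>\<^sup>+\<theta>. indicator {0..1} \<theta> * G (turn \<theta> *s \<zeta>) \<partial>lborel)"
      using entire_le_circle_mean[OF assms, of z \<zeta>]
      by (cases "\<zeta> \<in> ball 0 1") (auto simp: G_def indicator_def)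
  qed
  also have "\<dots> = (\<integral>\<^sup>+\<theta>. \<integral>\<^sup>+\<zeta>. indicator {0..1} \<theta> * G (turn \<theta> *s \<zeta>) \<partial>lborel \<partial>lborel)"
    by (rule lborel_pair.Fubini'[symmetric]) measurable
  also have "\<dots> = (\<integral>\<^sup>+\<theta>. indicator {0..1} \<theta> * (\<integral>\<^sup>+\<zeta>. G \<zeta> \<partial>lborel) \<partial>(lborel :: real measure))"
  proof (intro nn_integral_cong)
    fix \<theta> :: real
    have "continuous_on UNIV (\<lambda>\<zeta> :: complex ^ 'n. turn \<theta> *s \<zeta>)" by (intro continuous_intros)
    then have [measurable]: "(\<lambda>\<zeta> :: complex ^ 'n. turn \<theta> *s \<zeta>) \<in> borel_measurable borel"
      by (rule borel_measurable_continuous_onI)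
    show "(\<integral>\<^sup>+\<zeta>. indicator {0..1} \<theta> * G (turn \<theta> *s \<zeta>) \<partial>lborel) = indicator {0..1} \<theta> * (\<integral>\<^sup>+\<zeta>. G \<zeta> \<partial>lborel)"
      using nn_integral_lborel_turn[OF Gm, of \<theta>] by (simp add: nn_integral_cmult)
  qed
  also have "\<dots> = (\<integral>\<^sup>+\<zeta>. G \<zeta> \<partial>lborel)"
    by (simp add: nn_integral_multc)
  finally show ?thesis by (simp add: G_def)
qed

text \<open>Hoelder's inequality against an indicator. With \<open>C \<ge> 1\<close> the same constant serves all exponents.\<close>

lemma nn_integral_indicator_le_Lnorm:
  assumes p: "1 \<le> p" and [measurable]: "g \<in> borel_measurable M" "A \<in> sets M"
    and C: "1 \<le> C" "emeasure M A \<le> ennreal C"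
  shows "(\<integral>\<^sup>+z. indicator A z * g z \<partial>M) \<le> ennreal C * Lnorm M p g"
proof (cases "p = \<infinity>")
  case True
  have "AE z in M. g z \<le> esssup M g" by (rule esssup_AE)
  then have "(\<integral>\<^sup>+z. indicator A z * g z \<partial>M) \<le> (\<integral>\<^sup>+z. indicator A z * esssup M g \<partial>M)"
    by (intro nn_integral_mono_AE) (auto elim!: eventually_mono intro: mult_left_mono)
  also have "\<dots> = emeasure M A * esssup M g" by (simp add: nn_integral_multc)
  also have "\<dots> \<le> ennreal C * esssup M g" by (intro mult_right_mono C) auto
  finally show ?thesis using True by (simp add: Lnorm_def)
next
  case False
  define q where "q = enn2real p"
  have q: "1 \<le> q" using p False exponent_ge_1 q_def by blast
  have "epow (\<integral>\<^sup>+z. indicator A z * g z \<partial>M) q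
      \<le> ennreal (C powr (q - 1)) * (\<integral>\<^sup>+z. indicator A z * epow (g z) q \<partial>M)"
    using C q by (intro nn_integral_kernel_power) auto
  also have "\<dots> \<le> ennreal (C powr q) * (\<integral>\<^sup>+z. epow (g z) q \<partial>M)"
  proof (intro mult_mono nn_integral_mono ennreal_leI)
    show "C powr (q - 1) \<le> C powr q" using C by (intro powr_mono) auto
    show "indicator A z * epow (g z) q \<le> epow (g z) q" for z by (simp add: indicator_def)
  qed auto
  also have "\<dots> = epow (ennreal C * Lnorm M p g) q"
    using q C p False by (simp add: epow_mult epow_ennreal q_def epow_Lnorm)
  finally have "epow (epow (\<integral>\<^sup>+z. indicator A z * g z \<partial>M) q) (1 / q) \<le> epow (epow (ennreal C * Lnorm M p g) q) (1 / q)"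
    using q by (simp add: epow_mono)
  then show ?thesis using q by (simp add: epow_epow_inverse)
qed

lemma nn_integral_exp_le:
  assumes "0 < b"
  shows "(\<integral>\<^sup>+t. indicator {0<..<1} t * ennreal (exp (- b * (1 - t))) \<partial>lborel) \<le> ennreal (1 / b)"
proof -
  have "(\<integral>\<^sup>+t. indicator {0<..<1} t * ennreal (exp (- b * (1 - t))) \<partial>lborel)
      \<le> (\<integral>\<^sup>+t. ennreal (exp (- b * (1 - t))) * indicator {0..1} t \<partial>lborel)"
    by (intro nn_integral_mono) (auto simp: indicator_def)
  also have "\<dots> = ennreal (exp (- b * (1 - 1)) / b - exp (- b * (1 - 0)) / b)"
  proof (rule nn_integral_FTC_Icc)
    fix t :: real
    show "((\<lambda>t. exp (- b * (1 - t)) / b) has_real_derivative exp (- b * (1 - t))) (at t)"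
      using assms by (auto intro!: derivative_eq_intros)
  qed auto
  also have "\<dots> \<le> ennreal (1 / b)"
    using assms by (intro ennreal_leI) (simp add: divide_right_mono)
  finally show ?thesis .
qed

definition weight :: "real \<Rightarrow> real \<Rightarrow> real \<Rightarrow> 'a::real_normed_vector \<Rightarrow> real" where
  "weight l \<alpha> \<rho> z = (1 + norm z) powr \<rho> * exp (- (\<alpha> / 2) * norm z powr (2 * l))"

section \<open>The weights\<close>

lemma one_plus_norm_nonzero [simp]: "1 + norm z \<noteq> 0"
  by (metis add_nonneg_eq_0_iff norm_ge_zero zero_le_one zero_neq_one)

lemma weight_pos: "0 < weight l \<alpha> \<rho> z"
  by (simp add: weight_def)

lemma weight_nonneg [simp]: "0 \<le> weight l \<alpha> \<rho> z"
  using weight_pos less_imp_le by blast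

lemma continuous_on_weight: "1 \<le> l \<Longrightarrow> continuous_on S (weight l \<alpha> \<rho>)"
  unfolding weight_def
  by (intro continuous_intros continuous_on_powr') (auto simp: add_nonneg_eq_0_iff)

lemma measurable_weight [measurable]: "1 \<le> l \<Longrightarrow> weight l \<alpha> \<rho> \<in> borel_measurable borel"
  by (intro borel_measurable_continuous_onI continuous_on_weight)

lemma weight_diff:
  "weight l \<alpha> (\<rho> - m) z = weight l \<alpha> \<rho> z * (1 + norm z) powr - m"
  by (simp add: weight_def powr_diff powr_minus field_simps)

lemma weight_lower_bound:
  assumes "1 \<le> l"
  obtains c where "0 < c" "\<And>z :: 'a::euclidean_space. norm z \<le> R \<Longrightarrow> c \<le> weight l \<alpha> \<rho> z"
proof (cases "R < 0")
  case True
  show ?thesis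
  proof (rule that[of 1])
    show "1 \<le> weight l \<alpha> \<rho> z" if "norm z \<le> R" for z :: 'a
      using True that norm_ge_zero[of z] by linarith
  qed simp
next
  case False
  then have "cball (0 :: 'a) R \<noteq> {}" by simp
  from continuous_attains_inf[OF compact_cball this continuous_on_weight[OF assms, of _ \<alpha> \<rho>]]
  obtain x :: 'a where x: "\<And>y :: 'a. y \<in> cball 0 R \<Longrightarrow> weight l \<alpha> \<rho> x \<le> weight l \<alpha> \<rho> y"
    by blast
  show ?thesis
    by (rule that[of "weight l \<alpha> \<rho> x"]) (auto simp: weight_pos intro: x)
qed

lemma powr_le_exp:
  fixes M c :: real
  assumes "0 < c"
  obtains K where "0 < K" "\<And>y. 1 \<le> y \<Longrightarrow> y powr M \<le> K * exp (c * y)"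
proof -
  define N where "N = max M 1"
  have "y powr M \<le> (N / c) powr N * exp (c * y)" if y: "1 \<le> y" for y
  proof -
    have N: "0 < N" by (simp add: N_def)
    have "y powr M \<le> y powr N" using y by (intro powr_mono) (auto simp: N_def)
    also have "\<dots> = (N / c) powr N * (c * y / N) powr N"
      using assms y N by (subst powr_mult[symmetric]) auto
    also have "(c * y / N) powr N \<le> exp (c * y / N) powr N"
    proof (rule powr_mono2)
      show "c * y / N \<le> exp (c * y / N)" using exp_ge_add_one_self[of "c * y / N"] by linarith
    qed (use assms y N in auto)
    also have "exp (c * y / N) powr N = exp (c * y)"
      by (simp add: powr_def N_def)
    finally show ?thesis by (simp add: mult_left_mono)
  qed
  moreover have "0 < (N / c) powr N" using assms by (simp add: N_def)
  ultimately show ?thesis using that by blast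
qed

text \<open>Since \<open>x \<le> x powr (2 * l) + 1\<close>, the exponential factor beats every power of \<open>1 + |z|\<close>.\<close>

lemma weight_decay:
  fixes N :: real
  assumes "1 \<le> l" "0 < \<alpha>"
  obtains K where "0 < K" "\<And>z :: 'a::real_normed_vector. weight l \<alpha> \<rho> z \<le> K * (1 + norm z) powr - N"
proof -
  obtain K where K: "0 < K" "\<And>y. 1 \<le> y \<Longrightarrow> y powr (\<rho> + N) \<le> K * exp (\<alpha> / 2 * y)"
    using powr_le_exp[of "\<alpha> / 2" "\<rho> + N"] assms by auto
  have "weight l \<alpha> \<rho> z \<le> (K * exp \<alpha>) * (1 + norm z) powr - N" for z :: 'a
  proof -
    define x where "x = norm z"
    have x: "0 \<le> x" by (simp add: x_def)
    have "x \<le> x powr (2 * l) + 1"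
    proof (cases "x \<le> 1")
      case True
      then show ?thesis by (simp add: add_increasing)
    next
      case False
      then show ?thesis using assms powr_mono[of 1 "2 * l" x] by simp
    qed
    then have "\<alpha> / 2 * x \<le> \<alpha> / 2 * (x powr (2 * l) + 1)"
      using assms by (intro mult_left_mono) auto
    then have e: "exp (\<alpha> / 2 * (1 + x)) * exp (- (\<alpha> / 2) * x powr (2 * l)) \<le> exp \<alpha>"
      by (simp add: exp_add[symmetric] algebra_simps)
    have "weight l \<alpha> \<rho> z = (1 + x) powr (\<rho> + N) * exp (- (\<alpha> / 2) * x powr (2 * l)) * (1 + x) powr - N"
      using x by (simp add: weight_def x_def powr_add powr_minus field_simps)
    also have "\<dots> \<le> (K * exp (\<alpha> / 2 * (1 + x))) * exp (- (\<alpha> / 2) * x powr (2 * l)) * (1 + x) powr - N"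
      using x by (intro mult_right_mono K) auto
    also have "\<dots> = K * (exp (\<alpha> / 2 * (1 + x)) * exp (- (\<alpha> / 2) * x powr (2 * l))) * (1 + x) powr - N"
      by simp
    also have "\<dots> \<le> (K * exp \<alpha>) * (1 + x) powr - N"
      using K(1) by (intro mult_right_mono mult_left_mono e) auto
    finally show ?thesis by (simp add: x_def)
  qed
  then show ?thesis using K(1) that[of "K * exp \<alpha>"] by simp
qed

text \<open>The integrand is dominated by a sum over \<open>j\<close> of multiples of the indicators of the balls of radius
  \<open>1 + j\<close>; only the ball with \<open>j = \<lfloor>|z|\<rfloor>\<close> is used at \<open>z\<close>. Integrating leaves the series of inverse
  squares.\<close>

lemma nn_integral_decay_finite:
  "(\<integral>\<^sup>+z. ennreal ((1 + norm (z :: 'a::euclidean_space)) powr - (real DIM('a) + 2)) \<partial>lborel) < \<infinity>"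
proof -
  define D where "D = DIM('a)"
  define c where "c = (\<lambda>m::nat. (1 + real m) powr - (real D + 2))"
  have "(\<integral>\<^sup>+z. ennreal ((1 + norm (z :: 'a)) powr - (real D + 2)) \<partial>lborel)
      \<le> (\<integral>\<^sup>+z. (\<Sum>m. ennreal (c m) * indicator (ball (0 :: 'a) (1 + real m)) z) \<partial>lborel)"
  proof (rule nn_integral_mono)
    fix z :: 'a
    define m where "m = nat \<lfloor>norm z\<rfloor>"
    have m: "real m \<le> norm z" "norm z < 1 + real m"
      by (simp_all add: m_def) linarith
    define F where "F = (\<lambda>m. ennreal (c m) * indicator (ball 0 (1 + real m)) z)"
    have "ennreal ((1 + norm z) powr - (real D + 2)) \<le> F m"
      using m by (auto simp: F_def c_def intro!: ennreal_leI powr_mono2')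
    also have "\<dots> \<le> suminf F"
      using sum_le_suminf[of F "{m}"] by simp
    also have "\<dots> = (\<Sum>m. ennreal (c m) * indicator (ball 0 (1 + real m)) z)"
      by (simp add: F_def)
    finally show "ennreal ((1 + norm z) powr - (real D + 2)) \<le> (\<Sum>m. ennreal (c m) * indicator (ball 0 (1 + real m)) z)" .
  qed
  also have "\<dots> = (\<Sum>m. \<integral>\<^sup>+z. ennreal (c m) * indicator (ball (0 :: 'a) (1 + real m)) z \<partial>lborel)"
    by (rule nn_integral_suminf)
       (simp add: borel_measurable_times_ennreal borel_measurable_indicator)
  also have "\<dots> = (\<Sum>m. ennreal (unit_ball_vol D * (1 / (real (Suc m)) ^ 2)))"
  proof (rule arg_cong[where f = suminf], rule ext)
    fix m
    have "(1 + real m) powr - (real D + 2) * (1 + real m) ^ D = (1 + real m) powr (- (real D + 2) + real D)"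
      by (subst powr_add) (simp add: powr_realpow)
    also have "\<dots> = 1 / (1 + real m) ^ 2"
      by (simp add: powr_minus_divide)
    finally have power: "c m * (1 + real m) ^ D = 1 / (real (Suc m)) ^ 2"
      by (simp add: c_def)
    have "(\<integral>\<^sup>+z. ennreal (c m) * indicator (ball (0 :: 'a) (1 + real m)) z \<partial>lborel)
        = ennreal (c m) * emeasure lborel (ball (0 :: 'a) (1 + real m))"
      by (rule nn_integral_cmult_indicator) simp
    also have "\<dots> = ennreal (c m * (unit_ball_vol D * (1 + real m) ^ D))"
      by (simp only: emeasure_ball D_def) (simp add: ennreal_mult' c_def)
    also have "c m * (unit_ball_vol D * (1 + real m) ^ D) = unit_ball_vol D * (1 / (real (Suc m)) ^ 2)"
      unfolding power[symmetric] by (simp only: ac_simps)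
    finally show "(\<integral>\<^sup>+z. ennreal (c m) * indicator (ball (0 :: 'a) (1 + real m)) z \<partial>lborel)
        = ennreal (unit_ball_vol D * (1 / (real (Suc m)) ^ 2))" .
  qed
  also have "\<dots> < \<infinity>"
  proof -
    have "summable (\<lambda>m. 1 / (real (Suc m)) ^ 2)"
      using inverse_power_summable[of 2, where 'a = real] summable_Suc_iff[of "\<lambda>m. 1 / (real m) ^ 2"]
      by (simp only: inverse_eq_divide)
    then have "summable (\<lambda>m. unit_ball_vol D * (1 / (real (Suc m)) ^ 2))" by (rule summable_mult)
    then have "(\<Sum>m. ennreal (unit_ball_vol D * (1 / (real (Suc m)) ^ 2)))
        = ennreal (\<Sum>m. unit_ball_vol D * (1 / (real (Suc m)) ^ 2))"
      by (intro suminf_ennreal2) auto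
    then show ?thesis by (simp only: ennreal_less_top infinity_ennreal_def)
  qed
  finally show ?thesis by (simp add: D_def)
qed

lemma Lnorm_weight_finite:
  assumes "1 \<le> l" "0 < \<alpha>" "1 \<le> p"
  shows "Lnorm lborel p (\<lambda>z :: 'a::euclidean_space. ennreal (weight l \<alpha> \<rho> z)) < \<infinity>"
proof (cases "p = \<infinity>")
  case True
  obtain K where "\<And>z :: 'a. weight l \<alpha> \<rho> z \<le> K * (1 + norm z) powr - 0"
    using weight_decay[OF assms(1,2)] by metis
  then have "esssup lborel (\<lambda>z :: 'a. ennreal (weight l \<alpha> \<rho> z)) \<le> ennreal K"
    using assms(1) by (intro esssup_I AE_I2 ennreal_leI) (auto split: if_splits)
  also have "\<dots> < \<infinity>" by simp
  finally show ?thesis using True by (simp add: Lnorm_def)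
next
  case False
  define q where "q = enn2real p"
  have q: "1 \<le> q" using assms(3) False exponent_ge_1 q_def by blast
  define N where "N = real DIM('a) + 2"
  obtain K where K: "0 < K" "\<And>z :: 'a. weight l \<alpha> \<rho> z \<le> K * (1 + norm z) powr - N"
    using weight_decay[OF assms(1,2)] by metis
  have "(\<integral>\<^sup>+z. epow (ennreal (weight l \<alpha> \<rho> (z :: 'a))) q \<partial>lborel)
      \<le> (\<integral>\<^sup>+z. ennreal (K powr q) * ennreal ((1 + norm (z :: 'a)) powr - N) \<partial>lborel)"
  proof (rule nn_integral_mono)
    fix z :: 'a
    have "weight l \<alpha> \<rho> z powr q \<le> (K * (1 + norm z) powr - N) powr q"
      using q K by (intro powr_mono2) auto
    also have "\<dots> = K powr q * (1 + norm z) powr (- N * q)"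
      using K by (simp add: powr_mult powr_powr)
    also have "(1 + norm z) powr (- N * q) \<le> (1 + norm z) powr - N"
      using q by (intro powr_mono) (auto simp: N_def mult_le_cancel_left1)
    finally show "epow (ennreal (weight l \<alpha> \<rho> z)) q \<le> ennreal (K powr q) * ennreal ((1 + norm z) powr - N)"
      using K by (simp add: epow_ennreal ennreal_mult'[symmetric] mult_left_mono ennreal_leI)
  qed
  also have "\<dots> < \<infinity>"
    using nn_integral_decay_finite[where 'a = 'a]
    by (simp add: nn_integral_cmult N_def ennreal_mult_less_top)
  finally have "epow (Lnorm lborel p (\<lambda>z :: 'a. ennreal (weight l \<alpha> \<rho> z))) q < \<infinity>"
    using assms False by (simp add: epow_Lnorm q_def)
  then show ?thesis
    by (metis epow_top infinity_ennreal_def less_irrefl top.not_eq_extremum)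
qed

lemma powr_comparable:
  fixes u v s :: real
  assumes "0 < u" "0 < v" "u \<le> s * v" "v \<le> s * u"
  shows "u powr \<rho> \<le> s powr \<bar>\<rho>\<bar> * v powr \<rho>"
proof -
  have s: "0 < s" using assms by (metis less_le_trans zero_less_mult_pos2)
  show ?thesis
  proof (cases "0 \<le> \<rho>")
    case True
    have "u powr \<rho> \<le> (s * v) powr \<rho>" using assms True by (intro powr_mono2) auto
    then show ?thesis using assms s True by (simp add: powr_mult)
  next
    case False
    have "u powr \<rho> \<le> (v / s) powr \<rho>"
      using assms s False by (intro powr_mono2') (auto simp: field_simps)
    then show ?thesis using assms s False by (simp add: powr_divide powr_minus_divide)
  qed
qed

lemma slope_comparable:
  fixes z w :: "'a::real_normed_vector"
  assumes "norm (w - z) \<le> 1"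
  shows "(1 + norm z) powr \<rho> \<le> 2 powr \<bar>\<rho>\<bar> * (1 + norm w) powr \<rho>"
proof (rule powr_comparable)
  have "norm z \<le> norm w + norm (w - z)" "norm w \<le> norm z + norm (w - z)"
    by (metis norm_triangle_sub norm_minus_commute add.commute)+
  moreover have "0 \<le> norm z" "0 \<le> norm w" by simp_all
  ultimately show "1 + norm z \<le> 2 * (1 + norm w)" and "1 + norm w \<le> 2 * (1 + norm z)"
    using assms by argo+
qed (auto intro: add_pos_nonneg)

text \<open>The radius \<open>(1 + |z|)\<^sup>-\<^sup>m\<close> with \<open>m = 2 * l - 1\<close> is chosen so that \<open>|z|\<^sup>2\<^sup>l\<close>, whose slope is of order
  \<open>|z|\<^sup>m\<close>, grows by at most a constant between \<open>z\<close> and the points of the ball. The tangent inequality at the larger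
  of the two norms makes this precise.\<close>

lemma weight_near:
  assumes "1 \<le> l" "0 < \<alpha>"
  obtains C where "1 \<le> C" "\<And>z w :: 'a::real_normed_vector. norm (w - z) \<le> (1 + norm z) powr - (2 * l - 1) \<Longrightarrow>
    weight l \<alpha> \<rho> z \<le> C * weight l \<alpha> \<rho> w"
proof -
  define m where "m = 2 * l - 1"
  have m: "1 \<le> m" using assms by (simp add: m_def)
  define K where "K = 2 * l * 2 powr m"
  have bound: "weight l \<alpha> \<rho> z \<le> (2 powr \<bar>\<rho>\<bar> * exp (\<alpha> / 2 * K)) * weight l \<alpha> \<rho> w"
    if near: "norm (w - z) \<le> (1 + norm z) powr - m" for z w :: 'a
  proof -
    define a where "a = norm w"
    define b where "b = norm z"
    have b: "0 \<le> b" by (simp add: b_def)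
    have small: "(1 + b) powr - m \<le> 1"
      using b m by (simp add: powr_minus_divide ge_one_powr_ge_zero)
    have ab: "a - b \<le> (1 + b) powr - m"
      using near norm_triangle_ineq2[of w z] by (simp add: a_def b_def)
    have growth: "a powr (2 * l) - b powr (2 * l) \<le> K"
    proof (cases "a \<le> b")
      case True
      then have "a powr (2 * l) \<le> b powr (2 * l)" using assms by (intro powr_mono2) (auto simp: a_def)
      moreover have "0 \<le> K" using assms by (simp add: K_def)
      ultimately show ?thesis by simp
    next
      case False
      then have a: "0 < a" using b by simp
      have "2 * l * a powr m * b \<le> b powr (2 * l) + m * a powr (2 * l)"
        using powr_tangent[of "2 * l" a b] assms a b by (simp add: m_def)
      moreover have "a powr (2 * l) = a powr m * a"
        using a powr_add[of a m 1] by (simp add: m_def)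
      ultimately have "a powr (2 * l) - b powr (2 * l) \<le> 2 * l * a powr m * (a - b)"
        by (simp add: m_def algebra_simps)
      also have "\<dots> \<le> 2 * l * (2 * (1 + b)) powr m * (1 + b) powr - m"
        using a b ab small assms m False by (intro mult_mono powr_mono2) auto
      also have "\<dots> = K" using b by (subst powr_mult) (simp_all add: K_def powr_minus)
      finally show ?thesis .
    qed
    have "- (\<alpha> / 2) * b powr (2 * l) \<le> \<alpha> / 2 * K + - (\<alpha> / 2) * a powr (2 * l)"
      using mult_left_mono[OF growth, of "\<alpha> / 2"] assms by (simp add: algebra_simps)
    then have "exp (- (\<alpha> / 2) * b powr (2 * l)) \<le> exp (\<alpha> / 2 * K) * exp (- (\<alpha> / 2) * a powr (2 * l))"
      by (simp add: exp_add[symmetric])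
    moreover have "(1 + b) powr \<rho> \<le> 2 powr \<bar>\<rho>\<bar> * (1 + a) powr \<rho>"
      unfolding a_def b_def using near small by (intro slope_comparable) (simp add: b_def)
    ultimately have "(1 + b) powr \<rho> * exp (- (\<alpha> / 2) * b powr (2 * l))
        \<le> (2 powr \<bar>\<rho>\<bar> * (1 + a) powr \<rho>) * (exp (\<alpha> / 2 * K) * exp (- (\<alpha> / 2) * a powr (2 * l)))"
      by (intro mult_mono) auto
    then show ?thesis by (simp add: weight_def a_def b_def ac_simps)
  qed
  have "0 \<le> K" using assms by (simp add: K_def)
  then have "1 * 1 \<le> 2 powr \<bar>\<rho>\<bar> * exp (\<alpha> / 2 * K)"
    using assms by (intro mult_mono) (auto simp: ge_one_powr_ge_zero)
  with bound show ?thesis using that by (simp add: m_def)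
qed

text \<open>Half of the exponential decay of \<open>W\<^sub>\<rho>(z) / W\<^sub>\<rho>(t z)\<close> absorbs every power of \<open>1 / t\<close>: the exponent
  \<open>E = |z|\<^sup>2\<^sup>l (1 - t\<^sup>2\<^sup>l)\<close> is at least \<open>1 / t - 1\<close> when \<open>|t z| > 1\<close>. The factor \<open>t ^ D\<close> put aside in this way
  pays for the Jacobian \<open>t\<^sup>-\<^sup>D\<close> of the dilation by \<open>t\<close> in dimension \<open>D\<close>; the other half of the decay
  remains for the integration over \<open>t\<close>.\<close>

lemma weight_radial:
  fixes D :: nat
  assumes "1 \<le> l" "0 < \<alpha>"
  obtains C where "0 < C" "\<And>(z :: 'a::real_normed_vector) t. 0 < t \<Longrightarrow> t < 1 \<Longrightarrow> 1 < t * norm z \<Longrightarrow>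
    norm z * weight l \<alpha> \<rho> z \<le> C * t ^ D * (t * norm z) powr (2 * l)
      * exp (- (\<alpha> / 4) * (norm z powr (2 * l) * (1 - t powr (2 * l)))) * weight l \<alpha> (\<rho> - (2 * l - 1)) (t *\<^sub>R z)"
proof -
  define m where "m = 2 * l - 1"
  have m: "1 \<le> m" using assms by (simp add: m_def)
  define M where "M = \<bar>\<rho>\<bar> + 1 + real D"
  obtain K where K: "0 < K" "\<And>y. 1 \<le> y \<Longrightarrow> y powr M \<le> K * exp (\<alpha> / 4 * y)"
    using powr_le_exp[of "\<alpha> / 4" M] assms by auto
  define C where "C = 2 powr m * (K * exp (\<alpha> / 4))"
  have "norm z * weight l \<alpha> \<rho> z \<le> C * t ^ D * (t * norm z) powr (2 * l)
      * exp (- (\<alpha> / 4) * (norm z powr (2 * l) * (1 - t powr (2 * l)))) * weight l \<alpha> (\<rho> - m) (t *\<^sub>R z)"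
    if t: "0 < t" "t < 1" and tz: "1 < t * norm z" for z :: 'a and t
  proof -
    define x where "x = norm z"
    define u where "u = t * x"
    define s where "s = 1 / t"
    have s: "1 < s" using t by (simp add: s_def)
    have u: "1 < u" using tz by (simp add: u_def x_def)
    have "0 < t * x" using u by (simp add: u_def)
    then have x: "0 < x" using t by (simp add: zero_less_mult_iff)
    have xsu: "x = s * u" using t by (simp add: s_def u_def)
    define E where "E = x powr (2 * l) * (1 - t powr (2 * l))"
    have ut: "u powr (2 * l) = x powr (2 * l) * t powr (2 * l)"
      using x t by (simp add: u_def powr_mult)
    have E: "E = x powr (2 * l) - u powr (2 * l)"
      by (simp add: E_def ut right_diff_distrib)
    have "s - 1 \<le> s powr (2 * l) - 1"
      using s assms powr_mono[of 1 "2 * l" s] by simp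
    also have "\<dots> \<le> u powr (2 * l) * (s powr (2 * l) - 1)"
      using u s assms ge_one_powr_ge_zero[of u "2 * l"] ge_one_powr_ge_zero[of s "2 * l"]
      by (intro mult_le_cancel_right1[THEN iffD2]) auto
    also have "\<dots> = E"
      using xsu u s by (simp add: E powr_mult algebra_simps)
    finally have sE: "s - 1 \<le> E" .
    have absorb: "s powr M \<le> K * exp (\<alpha> / 4) * exp (\<alpha> / 4 * E)"
    proof -
      have "s powr M \<le> K * exp (\<alpha> / 4 * s)" using K(2) s by simp
      also have "\<dots> \<le> K * exp (\<alpha> / 4 + \<alpha> / 4 * E)"
        using sE K(1) assms mult_left_mono[OF sE, of "\<alpha> / 4"] by (simp add: algebra_simps)
      finally show ?thesis by (simp add: exp_add)
    qed
    have poly: "(1 + x) powr \<rho> \<le> s powr \<bar>\<rho>\<bar> * (1 + u) powr \<rho>"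
    proof (rule powr_comparable)
      show "1 + x \<le> s * (1 + u)" using s by (simp add: xsu distrib_left)
      have "u \<le> x" using t x by (simp add: u_def)
      then have "1 + u \<le> 1 * (1 + x)" by simp
      also have "\<dots> \<le> s * (1 + x)" using s x by (intro mult_right_mono) auto
      finally show "1 + u \<le> s * (1 + x)" .
    qed (use u x in auto)
    have slope: "(1 + u) powr \<rho> \<le> 2 powr m * u powr m * (1 + u) powr (\<rho> - m)"
    proof -
      have "(1 + u) powr \<rho> = (1 + u) powr m * (1 + u) powr (\<rho> - m)"
        by (simp add: powr_add[symmetric])
      also have "\<dots> \<le> (2 * u) powr m * (1 + u) powr (\<rho> - m)"
        using u m by (intro mult_right_mono powr_mono2) auto
      finally show ?thesis using u by (simp add: powr_mult)
    qed
    define e where "e = exp (- (\<alpha> / 2) * u powr (2 * l))"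
    have e: "exp (- (\<alpha> / 2) * x powr (2 * l)) = e * (exp (- (\<alpha> / 4) * E) * exp (- (\<alpha> / 4) * E))"
      by (simp add: e_def E exp_add[symmetric] algebra_simps)
    have "x * weight l \<alpha> \<rho> z = x * ((1 + x) powr \<rho> * exp (- (\<alpha> / 2) * x powr (2 * l)))"
      by (simp add: weight_def x_def)
    also have "\<dots> \<le> x * ((s powr \<bar>\<rho>\<bar> * (2 powr m * u powr m * (1 + u) powr (\<rho> - m)))
        * exp (- (\<alpha> / 2) * x powr (2 * l)))"
      using x order_trans[OF poly mult_left_mono[OF slope, of "s powr \<bar>\<rho>\<bar>"]]
      by (intro mult_left_mono mult_right_mono) auto
    also have "\<dots> = (s powr M * exp (- (\<alpha> / 4) * E)) *
        (2 powr m * t ^ D * u powr (2 * l) * exp (- (\<alpha> / 4) * E) * ((1 + u) powr (\<rho> - m) * e))"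
    proof -
      have "x * s powr \<bar>\<rho>\<bar> * u powr m = s powr M * t ^ D * u powr (2 * l)"
      proof -
        have "s powr M * t ^ D = s powr \<bar>\<rho>\<bar> * s"
          using s t by (simp add: M_def powr_add powr_realpow s_def power_one_over)
        moreover have "u powr (2 * l) = u powr m * u"
          using u powr_add[of u m 1] by (simp add: m_def)
        ultimately show ?thesis by (simp add: xsu)
      qed
      then show ?thesis unfolding e by (simp add: ac_simps)
    qed
    also have "\<dots> \<le> (K * exp (\<alpha> / 4)) *
        (2 powr m * t ^ D * u powr (2 * l) * exp (- (\<alpha> / 4) * E) * ((1 + u) powr (\<rho> - m) * e))"
    proof (rule mult_right_mono)
      have "s powr M * exp (- (\<alpha> / 4) * E) \<le> (K * exp (\<alpha> / 4) * exp (\<alpha> / 4 * E)) * exp (- (\<alpha> / 4) * E)"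
        by (intro mult_right_mono absorb) auto
      then show "s powr M * exp (- (\<alpha> / 4) * E) \<le> K * exp (\<alpha> / 4)"
        by (simp add: mult.assoc exp_add[symmetric])
    qed (use t in \<open>simp add: e_def\<close>)
    also have "\<dots> = C * t ^ D * u powr (2 * l) * exp (- (\<alpha> / 4) * E) * weight l \<alpha> (\<rho> - m) (t *\<^sub>R z)"
      using t by (simp add: C_def weight_def e_def u_def x_def)
    finally show ?thesis by (simp add: x_def u_def E_def)
  qed
  moreover have "0 < C" using K(1) by (simp add: C_def)
  ultimately show ?thesis using that by (simp add: m_def)
qed

section \<open>Bounding a partial derivative by the function\<close>

text \<open>The norm \<^const>\<open>wnorm\<close> with Lebesgue measure in place of \<^const>\<open>dV\<close>.\<close>

definition fnorm :: "real \<Rightarrow> ennreal \<Rightarrow> real \<Rightarrow> real \<Rightarrow> (complex ^ 'n::finite \<Rightarrow> 'b::real_normed_vector) \<Rightarrow> ennreal" where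
  "fnorm l p \<alpha> \<rho> f = Lnorm lborel p (\<lambda>z. ennreal (norm (f z) * weight l \<alpha> \<rho> z))"

lemma entire_measurable: "entire f \<Longrightarrow> f \<in> borel_measurable borel"
  by (intro borel_measurable_continuous_onI continuous_on_entire)

text \<open>Cauchy's estimate for one radius would involve the map \<open>z \<mapsto> z + axis j (r z * turn \<theta>)\<close>, which is awkward as a change
  of variables. Averaging the estimate over the radii \<open>s\<close> in \<open>(r(z) / 2, r(z)]\<close> makes the radius a parameter
  of the kernel, along with the angle, and \<open>\<tau>(\<sqdot>, (s, \<theta>))\<close> becomes a translation.\<close>

lemma fnorm_partial_le:
  assumes l: "1 \<le> l" and \<alpha>: "0 < \<alpha>" and p: "1 \<le> p"
  obtains C where "C < top" "\<And>(f :: complex ^ 'n \<Rightarrow> complex) j. entire f \<Longrightarrow>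
    fnorm l p \<alpha> (\<rho> - (2 * l - 1)) (partial j f) \<le> C * fnorm l p \<alpha> \<rho> f"
proof -
  define m where "m = 2 * l - 1"
  have m: "0 < m" using l by (simp add: m_def)
  define r where "r = (\<lambda>z :: complex ^ 'n. (1 + norm z) powr - m)"
  have r_pos: "0 < r z" for z by (simp add: r_def)
  have r_le_1: "r z \<le> 1" for z
    using m by (simp add: r_def powr_minus_divide ge_one_powr_ge_zero)
  have r_inv: "1 / r z = (1 + norm z) powr m" for z by (simp add: r_def powr_minus_divide)
  have [measurable]: "r \<in> borel_measurable borel" unfolding r_def by measurable
  obtain C1 where C1: "1 \<le> C1" "\<And>z w :: complex ^ 'n. norm (w - z) \<le> r z \<Longrightarrow> weight l \<alpha> \<rho> z \<le> C1 * weight l \<alpha> \<rho> w"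
    using weight_near[OF l \<alpha>] unfolding r_def m_def by metis
  define B where "B = 2 powr m"
  have B: "1 \<le> B" using m by (simp add: B_def ge_one_powr_ge_zero)
  define C where "C = 4 * C1 * B * B"
  have C: "0 < C" using C1(1) B by (simp add: C_def)
  (* Cauchy's estimate gives 1 / s \<le> 2 / r z, the average over an interval of length r z / 2 a second
     factor 2 / r z, and W (\<rho> - m) = W \<rho> * r removes one power of r z. In k' the point z is replaced by
     w = \<tau> z t, at the expense of the factor B by which r z and r w may differ. *)
  define k where "k = (\<lambda>(z :: complex ^ 'n) (t :: real \<times> real).
    ennreal (4 * C1 / r z) * indicator {r z / 2<..r z} (fst t) * indicator {0..1} (snd t))"
  define k' where "k' = (\<lambda>(w :: complex ^ 'n) (t :: real \<times> real).
    ennreal (4 * C1 * B / r w) * indicator {0<..B * r w} (fst t) * indicator {0..1} (snd t))"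
  define s1 s2 :: "real \<times> real \<Rightarrow> real" where "s1 = fst" and "s2 = snd"
  have [measurable]: "s1 \<in> borel_measurable borel" "s2 \<in> borel_measurable borel"
    unfolding s1_def s2_def by (intro borel_measurable_continuous_onI continuous_intros)+
  have k_eq: "k z t = (if r z / 2 < s1 t \<and> s1 t \<le> r z \<and> 0 \<le> s2 t \<and> s2 t \<le> 1 then ennreal (4 * C1 / r z) else 0)"
    and k'_eq: "k' z t = (if 0 < s1 t \<and> s1 t \<le> B * r z \<and> 0 \<le> s2 t \<and> s2 t \<le> 1 then ennreal (4 * C1 * B / r z) else 0)"
    for z t by (auto simp: k_def k'_def indicator_def s1_def s2_def)
  have box_integral: "(\<integral>\<^sup>+t. ennreal a * indicator {u<..v} (fst t) * indicator {0..1} (snd t) \<partial>(lborel :: (real \<times> real) measure))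
      = ennreal (a * (v - u))" if "0 \<le> a" "u \<le> v" for a u v :: real
  proof -
    have "(\<integral>\<^sup>+t. ennreal a * indicator {u<..v} (fst t) * indicator {0..1} (snd t) \<partial>(lborel :: (real \<times> real) measure))
        = (\<integral>\<^sup>+s. \<integral>\<^sup>+\<theta>. ennreal a * indicator {u<..v} s * indicator {0..1} \<theta> \<partial>(lborel :: real measure) \<partial>(lborel :: real measure))"
      by (subst lborel_prod[symmetric], subst lborel.nn_integral_fst[symmetric]) auto
    also have "\<dots> = ennreal (a * (v - u))"
      using that by (simp add: nn_integral_cmult ennreal_mult')
    finally show ?thesis .
  qed
  have near: "1 / r z \<le> B * (1 / r w)" "r z \<le> B * r w" if "norm (w - z) \<le> r z" for z w
    using slope_comparable[of w z m] slope_comparable[of w z "- m"] that r_le_1[of z] m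
    unfolding r_inv by (simp_all add: B_def r_def)
  have le: "fnorm l p \<alpha> (\<rho> - m) (partial j f) \<le> ennreal C * fnorm l p \<alpha> \<rho> f"
    if f: "entire f" for f :: "complex ^ 'n \<Rightarrow> complex" and j
  proof -
    have [measurable]: "f \<in> borel_measurable borel" "partial j f \<in> borel_measurable borel"
      using f entire_partial entire_measurable by blast+
    have wm [measurable]: "weight l \<alpha> \<rho> \<in> borel_measurable borel" for \<rho> using l by (rule measurable_weight)
    define G where "G = (\<lambda>w. ennreal (norm (f w) * weight l \<alpha> \<rho> w))"
    have [measurable]: "G \<in> borel_measurable borel" unfolding G_def by measurable
    define \<tau> where "\<tau> = (\<lambda>(z :: complex ^ 'n) (t :: real \<times> real). z + axis j (complex_of_real (fst t) * turn (snd t)))"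
    have tau_cont: "continuous_on UNIV (\<lambda>x. \<tau> (fst x) (snd x))"
      unfolding \<tau>_def by (intro continuous_intros)
    then have tau_meas: "(\<lambda>(z, t). \<tau> z t) \<in> borel_measurable (lborel \<Otimes>\<^sub>M lborel)"
      unfolding split_beta by (simp add: lborel_prod borel_measurable_continuous_onI)
    have tau_z: "(\<lambda>t. \<tau> z t) \<in> borel_measurable borel" for z
      by (intro borel_measurable_continuous_onI) (simp add: \<tau>_def continuous_intros)
    have norm_tau: "norm (\<tau> z t - z) = \<bar>fst t\<bar>" for z t
      by (simp add: \<tau>_def norm_mult)
    have "Lnorm lborel p (\<lambda>z. ennreal (norm (partial j f z) * weight l \<alpha> (\<rho> - m) z)) \<le> ennreal C * Lnorm lborel p G"
    proof (rule Schur_test[where k = k and k' = k' and \<tau> = \<tau> and N = "lborel :: (real \<times> real) measure"])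
      show "(\<lambda>(z, t). k z t) \<in> borel_measurable (lborel \<Otimes>\<^sub>M lborel)"
        "(\<lambda>(z, t). k' z t) \<in> borel_measurable (lborel \<Otimes>\<^sub>M lborel)"
        unfolding k_eq k'_eq by measurable
      show "(\<integral>\<^sup>+t. k z t \<partial>lborel) \<le> ennreal C" for z
      proof -
        have "(\<integral>\<^sup>+t. k z t \<partial>lborel) = ennreal (4 * C1 / r z * (r z - r z / 2))"
          unfolding k_def using C1(1) r_pos[of z] by (intro box_integral) auto
        also have "4 * C1 / r z * (r z - r z / 2) = 2 * C1" using r_pos[of z] by (simp add: field_simps)
        also have "ennreal (2 * C1) \<le> ennreal C"
        proof (rule ennreal_leI)
          have "1 * 1 \<le> B * B" using B by (intro mult_mono) auto
          then have "C1 * 1 \<le> C1 * (B * B)" using C1(1) by (intro mult_left_mono) auto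
          then show "2 * C1 \<le> C" using C1(1) by (simp add: C_def)
        qed
        finally show ?thesis .
      qed
      show "(\<integral>\<^sup>+t. k' w t \<partial>lborel) \<le> ennreal C" for w
      proof -
        have "(\<integral>\<^sup>+t. k' w t \<partial>lborel) = ennreal (4 * C1 * B / r w * (B * r w - 0))"
          unfolding k'_def using C1(1) r_pos[of w] B by (intro box_integral) auto
        then show ?thesis using r_pos[of w] by (simp add: C_def field_simps)
      qed
      show "(\<integral>\<^sup>+z. k z t * H (\<tau> z t) \<partial>lborel) \<le> (\<integral>\<^sup>+w. k' w t * H w \<partial>lborel)"
        if [measurable]: "H \<in> borel_measurable lborel" for t and H :: "complex ^ 'n \<Rightarrow> ennreal"
      proof -
        have pointwise: "k z t \<le> k' (\<tau> z t) t" for z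
        proof (cases "r z / 2 < fst t \<and> fst t \<le> r z")
          case True
          then have pos: "0 < fst t" using r_pos[of z] by linarith
          have close: "norm (\<tau> z t - z) \<le> r z" using True pos by (simp add: norm_tau)
          have "4 * C1 / r z \<le> 4 * C1 * B / r (\<tau> z t)"
            using mult_left_mono[OF near(1)[OF close], of "4 * C1"] C1(1) by simp
          then show ?thesis
            using True pos near(2)[OF close]
            by (auto simp: k_def k'_def indicator_def intro!: ennreal_leI)
        next
          case False
          then show ?thesis by (auto simp: k_def indicator_def)
        qed
        have "(\<lambda>w. k' w t * H w) \<in> borel_measurable borel" unfolding k'_eq by measurable
        then have "(\<integral>\<^sup>+w. k' w t * H w \<partial>lborel)
            = (\<integral>\<^sup>+z. k' (axis j (complex_of_real (fst t) * turn (snd t)) + z) t * H (axis j (complex_of_real (fst t) * turn (snd t)) + z) \<partial>lborel)"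
          by (rule nn_integral_lborel_translate[symmetric])
        also have "\<dots> = (\<integral>\<^sup>+z. k' (\<tau> z t) t * H (\<tau> z t) \<partial>lborel)"
          by (simp add: \<tau>_def add.commute)
        finally show ?thesis
          using pointwise by (auto intro!: nn_integral_mono mult_right_mono)
      qed
      show "ennreal (norm (partial j f z) * weight l \<alpha> (\<rho> - m) z) \<le> (\<integral>\<^sup>+t. k z t * G (\<tau> z t) \<partial>lborel)" for z
      proof -
        define P where "P = norm (partial j f z)"
        define W where "W = weight l \<alpha> \<rho> z"
        have W: "0 \<le> W" by (simp add: W_def)
        define J where "J = (\<lambda>s. \<integral>\<^sup>+\<theta>. indicator {0..1} \<theta> * ennreal (norm (f (\<tau> z (s, \<theta>)))) \<partial>lborel)"
        have "weight l \<alpha> (\<rho> - m) z = W * r z"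
          by (simp add: weight_diff W_def r_def)
        then have "norm (partial j f z) * weight l \<alpha> (\<rho> - m) z = 2 * W * (P * (r z - r z / 2))"
          by (simp add: P_def)
        moreover have "(\<integral>\<^sup>+s. ennreal P * indicator {r z / 2<..r z} s \<partial>lborel) = ennreal (P * (r z - r z / 2))"
          using r_pos[of z] by (subst nn_integral_cmult_indicator) (simp_all add: P_def ennreal_mult'[symmetric])
        ultimately have "ennreal (norm (partial j f z) * weight l \<alpha> (\<rho> - m) z)
            = ennreal (2 * W) * (\<integral>\<^sup>+s. ennreal P * indicator {r z / 2<..r z} s \<partial>lborel)"
          using W by (simp only:) (subst ennreal_mult', simp_all)
        also have "\<dots> = (\<integral>\<^sup>+s. ennreal (2 * W) * (ennreal P * indicator {r z / 2<..r z} s) \<partial>lborel)"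
          by (rule nn_integral_cmult[symmetric]) measurable
        also have "\<dots> \<le> (\<integral>\<^sup>+s. \<integral>\<^sup>+\<theta>. k z (s, \<theta>) * G (\<tau> z (s, \<theta>)) \<partial>lborel \<partial>lborel)"
        proof (rule nn_integral_mono)
          fix s :: real
          show "ennreal (2 * W) * (ennreal P * indicator {r z / 2<..r z} s)
              \<le> (\<integral>\<^sup>+\<theta>. k z (s, \<theta>) * G (\<tau> z (s, \<theta>)) \<partial>lborel)"
          proof (cases "s \<in> {r z / 2<..r z}")
            case True
            then have s: "0 < s" "r z / 2 < s" "s \<le> r z" using r_pos[of z] by auto
            have [measurable]: "(\<lambda>\<theta>. f (\<tau> z (s, \<theta>))) \<in> borel_measurable borel"
              unfolding \<tau>_def by (intro entire_measurable_compose f continuous_intros)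
            have "1 / s \<le> 2 / r z" using s r_pos[of z] by (simp add: field_simps)
            moreover have "ennreal P \<le> ennreal (1 / s) * J s"
              using partial_le_circle_mean[OF f s(1), of j z] by (simp add: P_def J_def \<tau>_def)
            ultimately have "ennreal P \<le> ennreal (2 / r z) * J s"
              by (meson order_trans mult_right_mono ennreal_leI zero_le)
            then have "ennreal (2 * W) * ennreal P \<le> ennreal (2 * W) * (ennreal (2 / r z) * J s)"
              by (rule mult_left_mono) simp
            also have "\<dots> = ennreal (2 * W) * ennreal (2 / r z) * J s"
              by (simp only: mult.assoc)
            also have "\<dots> = ennreal (4 * W / r z) * J s"
              using W by (subst ennreal_mult'[symmetric]) simp_all
            also have "\<dots> = (\<integral>\<^sup>+\<theta>. ennreal (4 * W / r z) * (indicator {0..1} \<theta> * ennreal (norm (f (\<tau> z (s, \<theta>))))) \<partial>lborel)"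
              unfolding J_def by (rule nn_integral_cmult[symmetric]) measurable
            also have "\<dots> \<le> (\<integral>\<^sup>+\<theta>. k z (s, \<theta>) * G (\<tau> z (s, \<theta>)) \<partial>lborel)"
            proof (rule nn_integral_mono)
              fix \<theta> :: real
              have "W \<le> C1 * weight l \<alpha> \<rho> (\<tau> z (s, \<theta>))"
                unfolding W_def using s by (intro C1(2)) (simp add: norm_tau)
              then have "4 / r z * norm (f (\<tau> z (s, \<theta>))) * W
                  \<le> 4 / r z * norm (f (\<tau> z (s, \<theta>))) * (C1 * weight l \<alpha> \<rho> (\<tau> z (s, \<theta>)))"
                using r_pos[of z] by (intro mult_left_mono) auto
              then have "4 * W / r z * norm (f (\<tau> z (s, \<theta>)))
                  \<le> 4 * C1 / r z * (norm (f (\<tau> z (s, \<theta>))) * weight l \<alpha> \<rho> (\<tau> z (s, \<theta>)))"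
                by (simp add: ac_simps)
              then have "ennreal (4 * W / r z) * ennreal (norm (f (\<tau> z (s, \<theta>)))) \<le> ennreal (4 * C1 / r z) * G (\<tau> z (s, \<theta>))"
                using W C1(1) r_pos[of z] by (simp add: G_def ennreal_mult'[symmetric] ennreal_leI)
              then show "ennreal (4 * W / r z) * (indicator {0..1} \<theta> * ennreal (norm (f (\<tau> z (s, \<theta>)))))
                  \<le> k z (s, \<theta>) * G (\<tau> z (s, \<theta>))"
                using True by (auto simp: k_def indicator_def)
            qed
            finally show ?thesis using True by simp
          qed simp
        qed
        also have "\<dots> = (\<integral>\<^sup>+t. k z t * G (\<tau> z t) \<partial>(lborel \<Otimes>\<^sub>M lborel))"
        proof (rule lborel.nn_integral_fst)
          note tau_z [measurable]
          have "(\<lambda>t. k z t * G (\<tau> z t)) \<in> borel_measurable borel"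
            unfolding k_eq by measurable
          then show "(\<lambda>t. k z t * G (\<tau> z t)) \<in> borel_measurable (lborel \<Otimes>\<^sub>M lborel)"
            by (simp add: lborel_prod)
        qed
        finally show ?thesis by (simp add: lborel_prod)
      qed
    qed (use p C tau_meas in \<open>simp_all add: sigma_finite_lborel\<close>)
    then show ?thesis by (simp add: fnorm_def G_def)
  qed
  show ?thesis using that[of "ennreal C"] le by (simp add: m_def)
qed

text \<open>On a bounded set all weights are comparable with \<open>1\<close>; the mean value property and Hoelder's
  inequality on the ball of radius \<open>2\<close> give the bound.\<close>

lemma entire_value_le_fnorm:
  assumes l: "1 \<le> l" and p: "1 \<le> p"
  obtains C where "C < top" "\<And>(f :: complex ^ 'n \<Rightarrow> complex) x. entire f \<Longrightarrow> norm x \<le> 1 \<Longrightarrow>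
    ennreal (norm (f x)) \<le> C * fnorm l p \<alpha> \<rho> f"
proof -
  define V where "V = emeasure lborel (ball (0 :: complex ^ 'n) 1)"
  have V: "0 < V" "V < \<infinity>" using emeasure_unit_ball[where 'a = "complex ^ 'n"] by (simp_all add: V_def)
  obtain c where c: "0 < c" "\<And>z :: complex ^ 'n. norm z \<le> 2 \<Longrightarrow> c \<le> weight l \<alpha> \<rho> z"
    using weight_lower_bound[OF l] by metis
  define A where "A = max 1 (measure lborel (ball (0 :: complex ^ 'n) 2))"
  have A: "1 \<le> A" "emeasure lborel (ball (0 :: complex ^ 'n) 2) \<le> ennreal A"
    by (simp_all add: A_def emeasure_eq_ennreal_measure emeasure_ball ennreal_leI)
  define C where "C = ennreal (1 / c) * ennreal A / V"
  have "ennreal (norm (f x)) \<le> C * fnorm l p \<alpha> \<rho> f"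
    if f: "entire f" and x: "norm x \<le> 1" for f :: "complex ^ 'n \<Rightarrow> complex" and x
  proof -
    have [measurable]: "f \<in> borel_measurable borel" "weight l \<alpha> \<rho> \<in> borel_measurable (borel :: (complex ^ 'n) measure)"
      using f l entire_measurable measurable_weight by blast+
    have [measurable]: "ball a r \<in> sets borel" for a :: "complex ^ 'n" and r by simp
    have "V * ennreal (norm (f x)) \<le> (\<integral>\<^sup>+\<zeta>. indicator (ball 0 1) \<zeta> * ennreal (norm (f (x + \<zeta>))) \<partial>lborel)"
      unfolding V_def by (rule entire_ball_mean[OF f])
    also have "\<dots> \<le> (\<integral>\<^sup>+\<zeta>. indicator (ball 0 2) (x + \<zeta>) * ennreal (norm (f (x + \<zeta>))) \<partial>lborel)"
    proof (intro nn_integral_mono mult_right_mono)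
      fix \<zeta> :: "complex ^ 'n"
      show "(indicator (ball 0 1) \<zeta> :: ennreal) \<le> indicator (ball 0 2) (x + \<zeta>)"
        using norm_triangle_ineq[of x \<zeta>] x by (auto simp: indicator_def)
    qed simp
    also have "\<dots> = (\<integral>\<^sup>+w. indicator (ball 0 2) w * ennreal (norm (f w)) \<partial>lborel)"
      by (rule nn_integral_lborel_translate[where f = "\<lambda>w. indicator (ball 0 2) w * ennreal (norm (f w))"]) measurable
    also have "\<dots> \<le> (\<integral>\<^sup>+w. ennreal (1 / c) * (indicator (ball 0 2) w * ennreal (norm (f w) * weight l \<alpha> \<rho> w)) \<partial>lborel)"
    proof (rule nn_integral_mono)
      fix w :: "complex ^ 'n"
      show "indicator (ball 0 2) w * ennreal (norm (f w))
          \<le> ennreal (1 / c) * (indicator (ball 0 2) w * ennreal (norm (f w) * weight l \<alpha> \<rho> w))"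
      proof (cases "w \<in> ball 0 2")
        case True
        then have "norm (f w) * c \<le> norm (f w) * weight l \<alpha> \<rho> w"
          by (intro mult_left_mono c) auto
        then have "norm (f w) \<le> 1 / c * (norm (f w) * weight l \<alpha> \<rho> w)"
          using c(1) by (simp add: field_simps)
        then have "ennreal (norm (f w)) \<le> ennreal (1 / c * (norm (f w) * weight l \<alpha> \<rho> w))"
          by (rule ennreal_leI)
        also have "\<dots> = ennreal (1 / c) * ennreal (norm (f w) * weight l \<alpha> \<rho> w)"
          using c(1) by (intro ennreal_mult') simp
        finally show ?thesis using True by simp
      qed simp
    qed
    also have "\<dots> = ennreal (1 / c) * (\<integral>\<^sup>+w. indicator (ball 0 2) w * ennreal (norm (f w) * weight l \<alpha> \<rho> w) \<partial>lborel)"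
      by (rule nn_integral_cmult) measurable
    also have "\<dots> \<le> ennreal (1 / c) * (ennreal A * fnorm l p \<alpha> \<rho> f)"
      unfolding fnorm_def by (intro mult_left_mono nn_integral_indicator_le_Lnorm p A) simp_all
    finally have "V * ennreal (norm (f x)) / V \<le> ennreal (1 / c) * (ennreal A * fnorm l p \<alpha> \<rho> f) / V"
      by (rule divide_right_mono_ennreal)
    moreover have "V * ennreal (norm (f x)) / V = ennreal (norm (f x))"
      using V by (subst mult.commute) (intro ennreal_mult_divide_eq, auto)
    moreover have "ennreal (1 / c) * (ennreal A * fnorm l p \<alpha> \<rho> f) / V = C * fnorm l p \<alpha> \<rho> f"
      by (simp only: C_def divide_ennreal_def ac_simps)
    ultimately show ?thesis by simp
  qed
  moreover have "C < top"
    using V by (simp add: C_def divide_ennreal_def ennreal_mult_less_top less_top[symmetric] ennreal_mult_eq_top_iff)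
  ultimately show ?thesis using that by blast
qed

section \<open>Bounding the function by its first partial derivatives\<close>

lemma entire_increment_le:
  fixes f :: "complex ^ 'n \<Rightarrow> complex"
  assumes f: "entire f"
  shows "ennreal (norm (f z - f 0)) \<le> (\<Sum>j\<in>UNIV. \<integral>\<^sup>+t. indicator {0..1} t *
    ennreal (norm z * norm (partial j f (t *\<^sub>R z))) \<partial>lborel)"
proof -
  define g where "g = (\<lambda>t::real. \<Sum>j\<in>UNIV. z $ j * partial j f (t *\<^sub>R z))"
  have pm: "partial j f \<in> borel_measurable borel" for j
    by (intro entire_measurable entire_partial f)
  have cont: "continuous_on {0..1} g"
    unfolding g_def by (intro continuous_intros continuous_on_compose2[OF continuous_on_partial[OF f, of UNIV]]) auto
  have "(g has_integral f (1 *\<^sub>R z) - f (0 *\<^sub>R z)) {0..1}"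
  proof (rule fundamental_theorem_of_calculus)
    fix t :: real
    have "((\<lambda>t. t *\<^sub>R z) has_derivative (\<lambda>h. h *\<^sub>R z)) (at t within {0..1})"
      by (intro bounded_linear_imp_has_derivative bounded_linear_scaleR_left)
    from has_derivative_compose[OF this entire_has_derivative[OF f]]
    have "((\<lambda>t. f (t *\<^sub>R z)) has_derivative (\<lambda>h. \<Sum>j\<in>UNIV. (h *\<^sub>R z) $ j * partial j f (t *\<^sub>R z))) (at t within {0..1})" .
    then show "((\<lambda>t. f (t *\<^sub>R z)) has_vector_derivative g t) (at t within {0..1})"
      unfolding has_vector_derivative_def g_def by (simp add: scaleR_sum_right)
  qed simp
  then have "ennreal (norm (f z - f 0)) \<le> (\<integral>\<^sup>+t. indicator {0..1} t * ennreal (norm (g t)) \<partial>lborel)"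
    using cont by (intro norm_has_integral_le_nn_integral) simp_all
  also have "\<dots> \<le> (\<integral>\<^sup>+t. (\<Sum>j\<in>UNIV. indicator {0..1} t * ennreal (norm z * norm (partial j f (t *\<^sub>R z)))) \<partial>lborel)"
  proof (rule nn_integral_mono)
    fix t :: real
    have "norm (g t) \<le> (\<Sum>j\<in>UNIV. norm z * norm (partial j f (t *\<^sub>R z)))"
      unfolding g_def by (rule sum_norm_le) (simp add: norm_mult mult_right_mono Finite_Cartesian_Product.norm_nth_le)
    then have "ennreal (norm (g t)) \<le> (\<Sum>j\<in>UNIV. ennreal (norm z * norm (partial j f (t *\<^sub>R z))))"
      by (simp add: sum_ennreal ennreal_leI)
    then show "indicator {0..1} t * ennreal (norm (g t))
        \<le> (\<Sum>j\<in>UNIV. indicator {0..1} t * ennreal (norm z * norm (partial j f (t *\<^sub>R z))))"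
      by (simp add: sum_distrib_left[symmetric] mult_left_mono)
  qed
  also have "\<dots> = (\<Sum>j\<in>UNIV. \<integral>\<^sup>+t. indicator {0..1} t * ennreal (norm z * norm (partial j f (t *\<^sub>R z))) \<partial>lborel)"
  proof (rule nn_integral_sum)
    fix j
    note pm [measurable]
    show "(\<lambda>t. indicator {0..1} t * ennreal (norm z * norm (partial j f (t *\<^sub>R z)))) \<in> borel_measurable lborel"
      by measurable
  qed
  finally show ?thesis .
qed

text \<open>The values of \<open>t\<close> with \<open>|t z| \<le> 1\<close> fill an interval of length at most \<open>1 / |z|\<close>, which cancels the
  factor \<open>|z|\<close>.\<close>

lemma nn_integral_segment_split:
  fixes h :: "'a::euclidean_space \<Rightarrow> real"
  assumes [measurable]: "h \<in> borel_measurable borel" and S: "\<And>x. norm x \<le> 1 \<Longrightarrow> ennreal (h x) \<le> S"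
  shows "(\<integral>\<^sup>+t. indicator {0..1} t * ennreal (norm z * h (t *\<^sub>R z)) \<partial>lborel)
    \<le> S + (\<integral>\<^sup>+t. indicator {t. 0 < t \<and> t < 1 \<and> 1 < t * norm z} t * ennreal (norm z * h (t *\<^sub>R z)) \<partial>lborel)"
proof -
  let ?I = "{t. 0 \<le> t \<and> t * norm z \<le> 1}"
  have "(\<integral>\<^sup>+t. indicator {0..1} t * ennreal (norm z * h (t *\<^sub>R z)) \<partial>lborel)
      \<le> (\<integral>\<^sup>+t. S * (ennreal (norm z) * indicator ?I t)
        + indicator {t. 0 < t \<and> t < 1 \<and> 1 < t * norm z} t * ennreal (norm z * h (t *\<^sub>R z)) \<partial>lborel)"
  proof (rule nn_integral_mono_AE)
    (* The last indicator leaves out the endpoint t = 1, a null set. *)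
    have "AE t::real in lborel. t \<noteq> 1" by (rule AE_lborel_singleton)
    then show "AE t in lborel. indicator {0..1} t * ennreal (norm z * h (t *\<^sub>R z))
      \<le> S * (ennreal (norm z) * indicator ?I t)
        + indicator {t. 0 < t \<and> t < 1 \<and> 1 < t * norm z} t * ennreal (norm z * h (t *\<^sub>R z))"
    proof eventually_elim
      case (elim t)
      consider "t \<notin> {0..1}" | "0 \<le> t" "t * norm z \<le> 1" | "0 < t" "t < 1" "1 < t * norm z"
        using elim by (cases "t = 0") force+
      then show ?case
      proof cases
        case 2
        then have "ennreal (h (t *\<^sub>R z)) \<le> S" by (intro S) simp
        then have "ennreal (norm z) * ennreal (h (t *\<^sub>R z)) \<le> ennreal (norm z) * S"
          by (rule mult_left_mono) simp
        with 2 show ?thesis by (auto simp: indicator_def ennreal_mult' mult.commute)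
      qed (auto simp: indicator_def)
    qed
  qed
  also have "\<dots> = S * (\<integral>\<^sup>+t. ennreal (norm z) * indicator ?I t \<partial>lborel)
      + (\<integral>\<^sup>+t. indicator {t. 0 < t \<and> t < 1 \<and> 1 < t * norm z} t * ennreal (norm z * h (t *\<^sub>R z)) \<partial>lborel)"
    by (subst nn_integral_add) (auto simp: nn_integral_cmult)
  finally have split: "(\<integral>\<^sup>+t. indicator {0..1} t * ennreal (norm z * h (t *\<^sub>R z)) \<partial>lborel) \<le> \<dots>" .
  have "(\<integral>\<^sup>+t. ennreal (norm z) * indicator ?I t \<partial>lborel) \<le> 1"
  proof (cases "z = 0")
    case False
    then have "?I = {0..1 / norm z}" by (auto simp: field_simps)
    then have "(\<integral>\<^sup>+t. ennreal (norm z) * indicator ?I t \<partial>lborel) = ennreal (norm z) * ennreal (1 / norm z)"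
      by (simp add: nn_integral_cmult_indicator)
    also have "\<dots> = 1" using False by (simp add: ennreal_mult'[symmetric])
    finally show ?thesis by simp
  qed simp
  then have "S * (\<integral>\<^sup>+t. ennreal (norm z) * indicator ?I t \<partial>lborel) \<le> S * 1"
    by (rule mult_left_mono) simp
  with split show ?thesis
    by (auto elim!: order_trans intro: add_right_mono)
qed

text \<open>The kernel supplied by \<open>weight_radial\<close> for the outer part of the segment, with \<open>\<tau>(z, t) = t z\<close>.\<close>

definition radial_kernel :: "real \<Rightarrow> real \<Rightarrow> real \<Rightarrow> 'a::euclidean_space \<Rightarrow> real \<Rightarrow> ennreal" where
  "radial_kernel l \<alpha> C z t = indicator {t. 0 < t \<and> t < 1 \<and> 1 < t * norm z} t *
    ennreal (C * t ^ DIM('a) * (t * norm z) powr (2 * l) * exp (- (\<alpha> / 4) * (norm z powr (2 * l) * (1 - t powr (2 * l)))))"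

lemma measurable_radial_kernel [measurable]:
  "(\<lambda>(z, t). radial_kernel l \<alpha> C (z :: 'a::euclidean_space) t) \<in> borel_measurable (lborel \<Otimes>\<^sub>M lborel)"
proof -
  have eq: "radial_kernel l \<alpha> C (z :: 'a) t = (if 0 < t \<and> t < 1 \<and> 1 < t * norm z then
    ennreal (C * t ^ DIM('a) * (t * norm z) powr (2 * l) * exp (- (\<alpha> / 4) * (norm z powr (2 * l) * (1 - t powr (2 * l))))) else 0)"
    for z t by (simp add: radial_kernel_def)
  show ?thesis unfolding eq by measurable
qed

lemma measurable_radial_operator:
  assumes [measurable]: "G \<in> borel_measurable (borel :: 'a::euclidean_space measure)"
  shows "(\<lambda>z. \<integral>\<^sup>+t. radial_kernel l \<alpha> C z t * G (t *\<^sub>R z) \<partial>lborel) \<in> borel_measurable lborel"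
  by (rule lborel.borel_measurable_nn_integral) measurable

text \<open>With \<open>u = |z|\<close> for the rows, and \<open>u = |w|\<close> for the columns after the dilation \<open>w = t z\<close>, whose Jacobian
  cancels \<open>t ^ DIM('a)\<close>, the kernel is at most \<open>C u\<^sup>2\<^sup>l exp (- \<alpha>/4 u\<^sup>2\<^sup>l (1 - t))\<close>. Its integral over \<open>t\<close> in
  \<open>(0, 1)\<close> is at most \<open>4 C / \<alpha>\<close>, whatever \<open>u\<close> is.\<close>

lemma radial_operator_bounded:
  assumes l: "1 \<le> l" and \<alpha>: "0 < \<alpha>" and p: "1 \<le> p" and C: "0 < C"
    and G [measurable]: "G \<in> borel_measurable (borel :: 'a::euclidean_space measure)"
  shows "Lnorm lborel p (\<lambda>z. \<integral>\<^sup>+t. radial_kernel l \<alpha> C z t * G (t *\<^sub>R z) \<partial>lborel)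
    \<le> ennreal (4 * C / \<alpha>) * Lnorm lborel p G"
proof -
  define e where "e = (\<lambda>(x :: real) (t :: real). indicator {0<..<1} t *
    ennreal (C * x powr (2 * l) * exp (- (\<alpha> / 4 * x powr (2 * l)) * (1 - t))))"
  have e_integral: "(\<integral>\<^sup>+t. e x t \<partial>lborel) \<le> ennreal (4 * C / \<alpha>)" if "0 \<le> x" for x
  proof (cases "x = 0")
    case False
    define b where "b = \<alpha> / 4 * x powr (2 * l)"
    have b: "0 < b" using False that \<alpha> by (simp add: b_def)
    have Cx: "C * x powr (2 * l) = 4 * C / \<alpha> * b" using \<alpha> by (simp add: b_def)
    have "(\<integral>\<^sup>+t. e x t \<partial>lborel)
        = (\<integral>\<^sup>+t. ennreal (4 * C / \<alpha> * b) * (indicator {0<..<1} t * ennreal (exp (- b * (1 - t)))) \<partial>lborel)"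
      unfolding e_def b_def[symmetric] Cx using \<alpha> C b
      by (intro nn_integral_cong) (auto simp: indicator_def ennreal_mult'[symmetric])
    also have "\<dots> = ennreal (4 * C / \<alpha> * b) * (\<integral>\<^sup>+t. indicator {0<..<1} t * ennreal (exp (- b * (1 - t))) \<partial>lborel)"
      by (rule nn_integral_cmult) measurable
    also have "\<dots> \<le> ennreal (4 * C / \<alpha> * b) * ennreal (1 / b)"
      by (intro mult_left_mono nn_integral_exp_le b) simp
    also have "\<dots> = ennreal (4 * C / \<alpha>)"
      using b C \<alpha> by (simp add: ennreal_mult'[symmetric])
    finally show ?thesis .
  qed (simp add: e_def)
  have kernel_le: "radial_kernel l \<alpha> C z t \<le> ennreal (t ^ DIM('a)) * e (norm (t *\<^sub>R z)) t"
    and kernel_le': "radial_kernel l \<alpha> C z t \<le> e (norm z) t" for z :: 'a and t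
  proof -
    let ?k = "C * t ^ DIM('a) * (t * norm z) powr (2 * l) * exp (- (\<alpha> / 4) * (norm z powr (2 * l) * (1 - t powr (2 * l))))"
    have "radial_kernel l \<alpha> C z t \<le> ennreal (t ^ DIM('a)) * e (norm (t *\<^sub>R z)) t \<and> radial_kernel l \<alpha> C z t \<le> e (norm z) t"
    proof (cases "0 < t \<and> t < 1 \<and> 1 < t * norm z")
      case True
      then have t: "0 < t" "t < 1" by auto
      have tz: "t * norm z \<le> norm z" using t by (simp add: mult_left_le_one_le)
      have mono: "(t * norm z) powr (2 * l) \<le> norm z powr (2 * l)"
        using t tz l by (intro powr_mono2) auto
      have "t powr (2 * l) \<le> t" using t l powr_mono'[of 1 "2 * l" t] by simp
      then have "norm z powr (2 * l) * (1 - t) \<le> norm z powr (2 * l) * (1 - t powr (2 * l))"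
        by (intro mult_left_mono) auto
      then have "\<alpha> / 4 * (norm z powr (2 * l) * (1 - t)) \<le> \<alpha> / 4 * (norm z powr (2 * l) * (1 - t powr (2 * l)))"
        by (rule mult_left_mono) (use \<alpha> in simp)
      then have exp1: "exp (- (\<alpha> / 4) * (norm z powr (2 * l) * (1 - t powr (2 * l)))) \<le> exp (- (\<alpha> / 4 * norm z powr (2 * l)) * (1 - t))"
        by (simp only: exp_le_cancel_iff mult_minus_left neg_le_iff_le mult.assoc)
      have "\<alpha> / 4 * (t * norm z) powr (2 * l) * (1 - t) \<le> \<alpha> / 4 * norm z powr (2 * l) * (1 - t)"
        using \<alpha> t mono by (intro mult_right_mono mult_left_mono) auto
      then have exp2: "exp (- (\<alpha> / 4 * norm z powr (2 * l)) * (1 - t)) \<le> exp (- (\<alpha> / 4 * (t * norm z) powr (2 * l)) * (1 - t))"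
        by (simp only: exp_le_cancel_iff mult_minus_left neg_le_iff_le mult.assoc)
      have "?k \<le> C * t ^ DIM('a) * (t * norm z) powr (2 * l) * exp (- (\<alpha> / 4 * (t * norm z) powr (2 * l)) * (1 - t))"
        using C t by (intro mult_left_mono order_trans[OF exp1 exp2]) auto
      also have "\<dots> = t ^ DIM('a) * (C * (t * norm z) powr (2 * l) * exp (- (\<alpha> / 4 * (t * norm z) powr (2 * l)) * (1 - t)))"
        by simp
      finally have "ennreal ?k \<le> ennreal \<dots>" by (rule ennreal_leI)
      also have "\<dots> = ennreal (t ^ DIM('a)) * e (norm (t *\<^sub>R z)) t"
        using t by (simp add: e_def ennreal_mult')
      finally have first: "ennreal ?k \<le> ennreal (t ^ DIM('a)) * e (norm (t *\<^sub>R z)) t" .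
      have "C * t ^ DIM('a) \<le> C" using C t by (simp add: mult_left_le power_le_one)
      then have "?k \<le> C * norm z powr (2 * l) * exp (- (\<alpha> / 4 * norm z powr (2 * l)) * (1 - t))"
        using C t mono exp1 by (intro mult_mono) auto
      then have "ennreal ?k \<le> e (norm z) t"
        using t by (simp add: e_def ennreal_leI)
      with first show ?thesis using True by (simp add: radial_kernel_def)
    next
      case False
      then show ?thesis by (simp add: radial_kernel_def)
    qed
    then show "radial_kernel l \<alpha> C z t \<le> ennreal (t ^ DIM('a)) * e (norm (t *\<^sub>R z)) t"
      "radial_kernel l \<alpha> C z t \<le> e (norm z) t" by auto
  qed
  note k_meas = measurable_radial_kernel[of l \<alpha> C, where 'a = 'a]
  have tau_meas [measurable]: "(\<lambda>(z :: 'a, t :: real). t *\<^sub>R z) \<in> lborel \<Otimes>\<^sub>M lborel \<rightarrow>\<^sub>M lborel"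
    by measurable
  have e_meas [measurable]: "(\<lambda>(z :: 'a, t). e (norm z) t) \<in> borel_measurable (lborel \<Otimes>\<^sub>M lborel)"
  proof -
    have eq: "e x t = (if 0 < t \<and> t < 1 then ennreal (C * x powr (2 * l) * exp (- (\<alpha> / 4 * x powr (2 * l)) * (1 - t))) else 0)"
      for x t by (simp add: e_def)
    show ?thesis unfolding eq by measurable
  qed
  show ?thesis
  proof (rule Schur_test[where k = "radial_kernel l \<alpha> C" and k' = "\<lambda>z. e (norm z)" and \<tau> = "\<lambda>z t. t *\<^sub>R z" and N = lborel])
    show "(\<integral>\<^sup>+t. radial_kernel l \<alpha> C z t \<partial>lborel) \<le> ennreal (4 * C / \<alpha>)" for z :: 'a
      by (rule order_trans[OF nn_integral_mono[OF kernel_le'] e_integral]) simp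
    show "(\<integral>\<^sup>+t. e (norm w) t \<partial>lborel) \<le> ennreal (4 * C / \<alpha>)" for w :: 'a
      by (rule e_integral) simp
    show "(\<integral>\<^sup>+z. radial_kernel l \<alpha> C z t * H (t *\<^sub>R z) \<partial>lborel) \<le> (\<integral>\<^sup>+w. e (norm w) t * H w \<partial>lborel)"
      if [measurable]: "H \<in> borel_measurable lborel" for t and H :: "'a \<Rightarrow> ennreal"
    proof (cases "0 < t \<and> t < 1")
      case True
      have m [measurable]: "(\<lambda>w :: 'a. e (norm w) t * H w) \<in> borel_measurable borel"
        unfolding e_def by measurable
      have "(\<integral>\<^sup>+z. radial_kernel l \<alpha> C z t * H (t *\<^sub>R z) \<partial>lborel)
          \<le> (\<integral>\<^sup>+z. ennreal (t ^ DIM('a)) * (e (norm (t *\<^sub>R z)) t * H (t *\<^sub>R z)) \<partial>lborel)"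
      proof (rule nn_integral_mono)
        fix z
        show "radial_kernel l \<alpha> C z t * H (t *\<^sub>R z) \<le> ennreal (t ^ DIM('a)) * (e (norm (t *\<^sub>R z)) t * H (t *\<^sub>R z))"
          unfolding mult.assoc[symmetric] by (rule mult_right_mono[OF kernel_le]) simp
      qed
      also have "\<dots> = ennreal (t ^ DIM('a)) * (\<integral>\<^sup>+z. e (norm (t *\<^sub>R z)) t * H (t *\<^sub>R z) \<partial>lborel)"
        by (rule nn_integral_cmult) (use measurable_compose[OF _ m, of "\<lambda>z. t *\<^sub>R z" lborel] in simp)
      also have "\<dots> = (\<integral>\<^sup>+w. e (norm w) t * H w \<partial>lborel)"
        by (rule nn_integral_lborel_scale[OF m, symmetric]) (use True in simp)
      finally show ?thesis .
    next
      case False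
      then have "radial_kernel l \<alpha> C z t = 0" for z :: 'a by (auto simp: radial_kernel_def)
      then show ?thesis by simp
    qed
    show "(\<lambda>z. \<integral>\<^sup>+t. radial_kernel l \<alpha> C z t * G (t *\<^sub>R z) \<partial>lborel) \<in> borel_measurable lborel"
      by (rule measurable_radial_operator[OF G])
  qed (use p C \<alpha> k_meas tau_meas e_meas G in \<open>simp_all add: sigma_finite_lborel\<close>)
qed

text \<open>The increment \<open>f(z) - f(0)\<close> is split along the segment: the part inside the unit ball contributes a
  multiple of the weight, whose norm is finite, and the outer part is the operator of
  \<open>radial_operator_bounded\<close>.\<close>

lemma fnorm_le_value_partials:
  assumes l: "1 \<le> l" and \<alpha>: "0 < \<alpha>" and p: "1 \<le> p"
  obtains C where "C < top" "\<And>f :: complex ^ 'n \<Rightarrow> complex. entire f \<Longrightarrow>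
    fnorm l p \<alpha> \<rho> f \<le> C * (ennreal (norm (f 0)) + (\<Sum>j\<in>UNIV. fnorm l p \<alpha> (\<rho> - (2 * l - 1)) (partial j f)))"
proof -
  define m where "m = 2 * l - 1"
  obtain C2 where C2: "C2 < top" "\<And>(f :: complex ^ 'n \<Rightarrow> complex) x. entire f \<Longrightarrow> norm x \<le> 1 \<Longrightarrow>
      ennreal (norm (f x)) \<le> C2 * fnorm l p \<alpha> (\<rho> - m) f"
    using entire_value_le_fnorm[OF l p] by metis
  obtain Cr where Cr: "0 < Cr" "\<And>(z :: complex ^ 'n) t. 0 < t \<Longrightarrow> t < 1 \<Longrightarrow> 1 < t * norm z \<Longrightarrow>
    norm z * weight l \<alpha> \<rho> z \<le> Cr * t ^ DIM(complex ^ 'n) * (t * norm z) powr (2 * l)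
      * exp (- (\<alpha> / 4) * (norm z powr (2 * l) * (1 - t powr (2 * l)))) * weight l \<alpha> (\<rho> - m) (t *\<^sub>R z)"
    using weight_radial[OF l \<alpha>, where 'a = "complex ^ 'n" and D = "DIM(complex ^ 'n)" and \<rho> = \<rho>] unfolding m_def by metis
  define Kr where "Kr = ennreal (4 * Cr / \<alpha>)"
  define A where "A = Lnorm lborel p (\<lambda>z :: complex ^ 'n. ennreal (weight l \<alpha> \<rho> z))"
  have A: "A < top" using Lnorm_weight_finite[OF l \<alpha> p, where 'a = "complex ^ 'n"] by (simp add: A_def)
  have W [measurable]: "weight l \<alpha> \<sigma> \<in> borel_measurable (borel :: (complex ^ 'n) measure)" for \<sigma>
    using l by (rule measurable_weight)
  define C where "C = A + C2 * A + Kr"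
  have bound: "fnorm l p \<alpha> \<rho> f \<le> C * (ennreal (norm (f 0)) + (\<Sum>j\<in>UNIV. fnorm l p \<alpha> (\<rho> - m) (partial j f)))"
    if f: "entire f" for f :: "complex ^ 'n \<Rightarrow> complex"
  proof -
    have [measurable]: "f \<in> borel_measurable borel" by (rule entire_measurable[OF f])
    have pm [measurable]: "partial j f \<in> borel_measurable borel" for j
      by (intro entire_measurable entire_partial f)
    define X where "X = (\<lambda>j. fnorm l p \<alpha> (\<rho> - m) (partial j f))"
    define w where "w = (\<lambda>z :: complex ^ 'n. ennreal (weight l \<alpha> \<rho> z))"
    have [measurable]: "w \<in> borel_measurable borel" unfolding w_def by measurable
    define G where "G = (\<lambda>j z. ennreal (norm (partial j f z) * weight l \<alpha> (\<rho> - m) z))"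
    have Gm [measurable]: "G j \<in> borel_measurable borel" for j unfolding G_def by measurable
    define T where "T = (\<lambda>j z. \<integral>\<^sup>+t. radial_kernel l \<alpha> Cr z t * G j (t *\<^sub>R z) \<partial>lborel)"
    have Tm [measurable]: "T j \<in> borel_measurable borel" for j
      using measurable_radial_operator[OF Gm, of l \<alpha> Cr j] by (simp add: T_def)
    have pointwise: "ennreal (norm (f z) * weight l \<alpha> \<rho> z)
        \<le> ennreal (norm (f 0)) * w z + (\<Sum>j\<in>UNIV. (C2 * X j) * w z + T j z)" for z
    proof -
      have segment: "(\<integral>\<^sup>+t. indicator {0..1} t * ennreal (norm z * norm (partial j f (t *\<^sub>R z))) \<partial>lborel) * w z
          \<le> (C2 * X j) * w z + T j z" for j
      proof -
        define I where "I = (\<lambda>t. indicator {t. 0 < t \<and> t < 1 \<and> 1 < t * norm z} t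
          * ennreal (norm z * norm (partial j f (t *\<^sub>R z))))"
        have Im [measurable]: "I \<in> borel_measurable borel" unfolding I_def by measurable
        have "(\<integral>\<^sup>+t. indicator {0..1} t * ennreal (norm z * norm (partial j f (t *\<^sub>R z))) \<partial>lborel)
            \<le> C2 * X j + (\<integral>\<^sup>+t. I t \<partial>lborel)"
          unfolding I_def X_def
          by (rule nn_integral_segment_split[where h = "\<lambda>x. norm (partial j f x)"])
             (measurable, intro C2 entire_partial f)
        then have "(\<integral>\<^sup>+t. indicator {0..1} t * ennreal (norm z * norm (partial j f (t *\<^sub>R z))) \<partial>lborel) * w z
            \<le> (C2 * X j + (\<integral>\<^sup>+t. I t \<partial>lborel)) * w z"
          by (rule mult_right_mono) simp
        also have "\<dots> = (C2 * X j) * w z + (\<integral>\<^sup>+t. I t * w z \<partial>lborel)"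
          by (simp add: distrib_right nn_integral_multc)
        also have "(\<integral>\<^sup>+t. I t * w z \<partial>lborel) \<le> T j z"
          unfolding T_def
        proof (rule nn_integral_mono)
          fix t :: real
          show "I t * w z \<le> radial_kernel l \<alpha> Cr z t * G j (t *\<^sub>R z)"
          proof (cases "0 < t \<and> t < 1 \<and> 1 < t * norm z")
            case True
            define c where "c = Cr * t ^ DIM(complex ^ 'n) * (t * norm z) powr (2 * l)
              * exp (- (\<alpha> / 4) * (norm z powr (2 * l) * (1 - t powr (2 * l))))"
            have c: "0 \<le> c" using Cr(1) True by (simp add: c_def)
            define P where "P = norm (partial j f (t *\<^sub>R z))"
            have "norm z * P * weight l \<alpha> \<rho> z = P * (norm z * weight l \<alpha> \<rho> z)" by (simp only: ac_simps)
            also have "\<dots> \<le> P * (c * weight l \<alpha> (\<rho> - m) (t *\<^sub>R z))"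
              using True unfolding c_def by (intro mult_left_mono Cr(2)) (auto simp: P_def)
            also have "\<dots> = c * (P * weight l \<alpha> (\<rho> - m) (t *\<^sub>R z))" by (simp only: ac_simps)
            finally have "ennreal (norm z * P * weight l \<alpha> \<rho> z) \<le> ennreal (c * (P * weight l \<alpha> (\<rho> - m) (t *\<^sub>R z)))"
              by (rule ennreal_leI)
            moreover have "I t * w z = ennreal (norm z * P * weight l \<alpha> \<rho> z)"
              using True by (simp add: I_def w_def P_def ennreal_mult')
            moreover have "radial_kernel l \<alpha> Cr z t * G j (t *\<^sub>R z) = ennreal (c * (P * weight l \<alpha> (\<rho> - m) (t *\<^sub>R z)))"
              using True c unfolding radial_kernel_def c_def[symmetric] G_def P_def[symmetric]
              by (subst ennreal_mult') simp_all
            ultimately show ?thesis by simp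
          qed (simp add: I_def)
        qed
        finally show ?thesis by (simp add: add_left_mono)
      qed
      have "norm (f z) * weight l \<alpha> \<rho> z \<le> (norm (f 0) + norm (f z - f 0)) * weight l \<alpha> \<rho> z"
        using norm_triangle_sub[of "f z" "f 0"] by (intro mult_right_mono) auto
      then have "ennreal (norm (f z) * weight l \<alpha> \<rho> z) \<le> ennreal ((norm (f 0) + norm (f z - f 0)) * weight l \<alpha> \<rho> z)"
        by (rule ennreal_leI)
      also have "\<dots> = ennreal (norm (f 0)) * w z + ennreal (norm (f z - f 0)) * w z"
        by (subst distrib_right) (simp add: w_def ennreal_mult')
      also have "ennreal (norm (f z - f 0)) * w z
          \<le> (\<Sum>j\<in>UNIV. \<integral>\<^sup>+t. indicator {0..1} t * ennreal (norm z * norm (partial j f (t *\<^sub>R z))) \<partial>lborel) * w z"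
        by (intro mult_right_mono entire_increment_le f) simp
      also have "\<dots> \<le> (\<Sum>j\<in>UNIV. (C2 * X j) * w z + T j z)"
        unfolding sum_distrib_right by (intro sum_mono segment)
      finally show ?thesis by (simp add: add_left_mono)
    qed
    have "fnorm l p \<alpha> \<rho> f \<le> Lnorm lborel p (\<lambda>z. ennreal (norm (f 0)) * w z + (\<Sum>j\<in>UNIV. (C2 * X j) * w z + T j z))"
      unfolding fnorm_def by (intro Lnorm_mono p pointwise) measurable
    also have "\<dots> \<le> Lnorm lborel p (\<lambda>z. ennreal (norm (f 0)) * w z) + Lnorm lborel p (\<lambda>z. \<Sum>j\<in>UNIV. (C2 * X j) * w z + T j z)"
      by (intro Lnorm_triangle p) measurable
    also have "\<dots> \<le> ennreal (norm (f 0)) * A + (\<Sum>j\<in>UNIV. (C2 * X j) * A + Kr * X j)"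
    proof (rule add_mono)
      show "Lnorm lborel p (\<lambda>z. ennreal (norm (f 0)) * w z) \<le> ennreal (norm (f 0)) * A"
        unfolding A_def w_def by (intro Lnorm_cmult p) measurable
      have "Lnorm lborel p (\<lambda>z. \<Sum>j\<in>UNIV. (C2 * X j) * w z + T j z) \<le> (\<Sum>j\<in>UNIV. Lnorm lborel p (\<lambda>z. (C2 * X j) * w z + T j z))"
        by (intro Lnorm_sum p) measurable
      also have "\<dots> \<le> (\<Sum>j\<in>UNIV. (C2 * X j) * A + Kr * X j)"
      proof (rule sum_mono)
        fix j
        have "Lnorm lborel p (\<lambda>z. (C2 * X j) * w z + T j z) \<le> Lnorm lborel p (\<lambda>z. (C2 * X j) * w z) + Lnorm lborel p (T j)"
          by (intro Lnorm_triangle p) measurable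
        also have "\<dots> \<le> (C2 * X j) * A + Kr * X j"
        proof (rule add_mono)
          show "Lnorm lborel p (\<lambda>z. (C2 * X j) * w z) \<le> (C2 * X j) * A"
            unfolding A_def w_def by (intro Lnorm_cmult p) measurable
          show "Lnorm lborel p (T j) \<le> Kr * X j"
            using radial_operator_bounded[OF l \<alpha> p Cr(1) Gm, of j] by (simp add: T_def Kr_def X_def fnorm_def G_def)
        qed
        finally show "Lnorm lborel p (\<lambda>z. (C2 * X j) * w z + T j z) \<le> (C2 * X j) * A + Kr * X j" .
      qed
      finally show "Lnorm lborel p (\<lambda>z. \<Sum>j\<in>UNIV. (C2 * X j) * w z + T j z) \<le> (\<Sum>j\<in>UNIV. (C2 * X j) * A + Kr * X j)" .
    qed
    also have "\<dots> = A * ennreal (norm (f 0)) + (C2 * A + Kr) * (\<Sum>j\<in>UNIV. X j)"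
    proof -
      have "(C2 * X j) * A + Kr * X j = (C2 * A + Kr) * X j" for j
        by (simp add: distrib_left distrib_right ac_simps)
      then show ?thesis by (simp add: sum_distrib_left mult.commute[of A])
    qed
    also have "\<dots> \<le> C * ennreal (norm (f 0)) + C * (\<Sum>j\<in>UNIV. X j)"
      by (intro add_mono mult_right_mono) (simp_all add: C_def add.assoc add_increasing add_increasing2)
    finally show ?thesis by (simp add: X_def distrib_left)
  qed
  have "C < top" using A C2(1) by (simp add: C_def Kr_def ennreal_mult_less_top)
  with bound show ?thesis using that by (simp add: m_def)
qed

section \<open>Derivatives of higher order\<close>

lemma continuous_on_nabla_abs: "entire f \<Longrightarrow> continuous_on S (nabla_abs k f)"
  unfolding nabla_abs_def by (intro continuous_intros continuous_on_entire entire_mpartial)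

lemma nabla_abs_nonneg: "0 \<le> nabla_abs k f z"
  unfolding nabla_abs_def by (intro sum_nonneg) simp

lemma norm_mpartial_le_nabla_abs: "sum \<nu> UNIV = k \<Longrightarrow> norm (mpartial \<nu> f z) \<le> nabla_abs k f z"
  unfolding nabla_abs_def
  by (rule member_le_sum[where f = "\<lambda>\<nu>. norm (mpartial \<nu> f z)"]) (auto simp: finite_multi_indices)

lemma fnorm_mpartial_le_nabla_abs:
  fixes f :: "complex ^ 'n \<Rightarrow> complex"
  assumes "1 \<le> l" "1 \<le> p" "entire f" "sum \<nu> UNIV = k"
  shows "fnorm l p \<alpha> \<rho> (mpartial \<nu> f) \<le> fnorm l p \<alpha> \<rho> (nabla_abs k f)"
  unfolding fnorm_def
proof (rule Lnorm_mono[OF assms(2)])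
  have [measurable]: "mpartial \<nu> f \<in> borel_measurable borel" "weight l \<alpha> \<rho> \<in> borel_measurable (borel :: (complex ^ 'n) measure)"
    using assms by (auto intro!: entire_measurable entire_mpartial measurable_weight)
  show "(\<lambda>z. ennreal (norm (mpartial \<nu> f z) * weight l \<alpha> \<rho> z)) \<in> borel_measurable lborel" by measurable
  show "ennreal (norm (mpartial \<nu> f z) * weight l \<alpha> \<rho> z) \<le> ennreal (norm (nabla_abs k f z) * weight l \<alpha> \<rho> z)" for z
    using norm_mpartial_le_nabla_abs[OF assms(4), of f z]
    by (intro ennreal_leI mult_right_mono) (auto simp: nabla_abs_nonneg)
qed

lemma fnorm_nabla_abs_le_sum:
  fixes f :: "complex ^ 'n \<Rightarrow> complex"
  assumes "1 \<le> l" "1 \<le> p" "entire f"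
  shows "fnorm l p \<alpha> \<rho> (nabla_abs k f) \<le> (\<Sum>\<nu> | sum \<nu> UNIV = k. fnorm l p \<alpha> \<rho> (mpartial \<nu> f))"
proof -
  have W [measurable]: "weight l \<alpha> \<rho> \<in> borel_measurable (borel :: (complex ^ 'n) measure)"
    using assms(1) by (rule measurable_weight)
  have M [measurable]: "mpartial \<nu> f \<in> borel_measurable borel" for \<nu>
    using assms by (intro entire_measurable entire_mpartial)
  have "fnorm l p \<alpha> \<rho> (nabla_abs k f)
      = Lnorm lborel p (\<lambda>z. \<Sum>\<nu> | sum \<nu> UNIV = k. ennreal (norm (mpartial \<nu> f z) * weight l \<alpha> \<rho> z))"
    unfolding fnorm_def by (simp add: nabla_abs_nonneg sum_ennreal) (simp add: nabla_abs_def sum_distrib_right)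
  also have "\<dots> \<le> (\<Sum>\<nu> | sum \<nu> UNIV = k. fnorm l p \<alpha> \<rho> (mpartial \<nu> f))"
    unfolding fnorm_def by (intro Lnorm_sum assms finite_multi_indices) measurable
  finally show ?thesis .
qed

lemma fnorm_mpartial_le:
  assumes l: "1 \<le> l" and \<alpha>: "0 < \<alpha>" and p: "1 \<le> p"
  shows "\<exists>C<top. \<forall>(f :: complex ^ 'n \<Rightarrow> complex) \<nu>. entire f \<longrightarrow> sum \<nu> UNIV = k \<longrightarrow>
    fnorm l p \<alpha> (\<rho> - real k * (2 * l - 1)) (mpartial \<nu> f) \<le> C * fnorm l p \<alpha> \<rho> f"
proof (induction k)
  case 0
  show ?case
  proof (intro exI[of _ 1] conjI allI impI)
    fix f :: "complex ^ 'n \<Rightarrow> complex" and \<nu> :: "'n \<Rightarrow> nat"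
    assume "sum \<nu> UNIV = 0"
    then have "\<nu> = (\<lambda>_. 0)" by (simp add: fun_eq_iff)
    then show "fnorm l p \<alpha> (\<rho> - real 0 * (2 * l - 1)) (mpartial \<nu> f) \<le> 1 * fnorm l p \<alpha> \<rho> f"
      by (simp add: mpartial_zero)
  qed simp
next
  case (Suc k)
  then obtain C where C: "C < top" "\<And>(f :: complex ^ 'n \<Rightarrow> complex) \<nu>. entire f \<Longrightarrow> sum \<nu> UNIV = k \<Longrightarrow>
      fnorm l p \<alpha> (\<rho> - real k * (2 * l - 1)) (mpartial \<nu> f) \<le> C * fnorm l p \<alpha> \<rho> f"
    by blast
  obtain C' where C': "C' < top" "\<And>(f :: complex ^ 'n \<Rightarrow> complex) j. entire f \<Longrightarrow>
      fnorm l p \<alpha> ((\<rho> - real k * (2 * l - 1)) - (2 * l - 1)) (partial j f) \<le> C' * fnorm l p \<alpha> (\<rho> - real k * (2 * l - 1)) f"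
    using fnorm_partial_le[OF l \<alpha> p] by metis
  have index: "\<rho> - real (Suc k) * (2 * l - 1) = (\<rho> - real k * (2 * l - 1)) - (2 * l - 1)"
    by (simp add: algebra_simps)
  have "fnorm l p \<alpha> (\<rho> - real (Suc k) * (2 * l - 1)) (mpartial \<nu> f) \<le> (C' * C) * fnorm l p \<alpha> \<rho> f"
    if f: "entire f" and \<nu>: "sum \<nu> UNIV = Suc k" for f :: "complex ^ 'n \<Rightarrow> complex" and \<nu>
  proof -
    obtain i \<mu> where \<mu>: "sum \<mu> UNIV = k" "mpartial \<nu> f = partial i (mpartial \<mu> f)"
      using mpartial_Suc_decompose[OF f \<nu>] by blast
    have "fnorm l p \<alpha> (\<rho> - real (Suc k) * (2 * l - 1)) (mpartial \<nu> f)
        \<le> C' * fnorm l p \<alpha> (\<rho> - real k * (2 * l - 1)) (mpartial \<mu> f)"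
      unfolding \<mu>(2) index by (rule C'(2)[OF entire_mpartial[OF f]])
    also have "\<dots> \<le> C' * (C * fnorm l p \<alpha> \<rho> f)"
      by (intro mult_left_mono C(2) f \<mu>(1)) simp
    finally show ?thesis by (simp add: mult.assoc)
  qed
  moreover have "C' * C < top" using C(1) C'(1) by (simp add: ennreal_mult_less_top)
  ultimately show ?case by blast
qed

lemma fnorm_nabla_abs_le:
  assumes l: "1 \<le> l" and \<alpha>: "0 < \<alpha>" and p: "1 \<le> p"
  obtains C where "C < top" "\<And>f :: complex ^ 'n \<Rightarrow> complex. entire f \<Longrightarrow>
    fnorm l p \<alpha> (\<rho> - real k * (2 * l - 1)) (nabla_abs k f) \<le> C * fnorm l p \<alpha> \<rho> f"
proof -
  obtain C where C: "C < top" "\<And>(f :: complex ^ 'n \<Rightarrow> complex) \<nu>. entire f \<Longrightarrow> sum \<nu> UNIV = k \<Longrightarrow>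
      fnorm l p \<alpha> (\<rho> - real k * (2 * l - 1)) (mpartial \<nu> f) \<le> C * fnorm l p \<alpha> \<rho> f"
    using fnorm_mpartial_le[OF l \<alpha> p] by metis
  define N where "N = card {\<nu> :: 'n \<Rightarrow> nat. sum \<nu> UNIV = k}"
  have "fnorm l p \<alpha> (\<rho> - real k * (2 * l - 1)) (nabla_abs k f) \<le> (of_nat N * C) * fnorm l p \<alpha> \<rho> f"
    if f: "entire f" for f :: "complex ^ 'n \<Rightarrow> complex"
  proof -
    have "fnorm l p \<alpha> (\<rho> - real k * (2 * l - 1)) (nabla_abs k f) \<le> (\<Sum>\<nu> | sum \<nu> UNIV = k. fnorm l p \<alpha> (\<rho> - real k * (2 * l - 1)) (mpartial \<nu> f))"
      by (rule fnorm_nabla_abs_le_sum[OF l p f])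
    also have "\<dots> \<le> (\<Sum>\<nu> :: 'n \<Rightarrow> nat | sum \<nu> UNIV = k. C * fnorm l p \<alpha> \<rho> f)"
      by (intro sum_mono C(2) f) simp
    finally show ?thesis by (simp add: N_def mult.assoc)
  qed
  moreover have "of_nat N * C < top" using C(1) by (simp add: ennreal_mult_less_top of_nat_less_top)
  ultimately show ?thesis using that by blast
qed

lemma nabla_abs_0_le_fnorm:
  assumes l: "1 \<le> l" and \<alpha>: "0 < \<alpha>" and p: "1 \<le> p"
  obtains C where "C < top" "\<And>f :: complex ^ 'n \<Rightarrow> complex. entire f \<Longrightarrow>
    ennreal (nabla_abs k f 0) \<le> C * fnorm l p \<alpha> \<rho> f"
proof -
  obtain C where C: "C < top" "\<And>(f :: complex ^ 'n \<Rightarrow> complex) \<nu>. entire f \<Longrightarrow> sum \<nu> UNIV = k \<Longrightarrow>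
      fnorm l p \<alpha> (\<rho> - real k * (2 * l - 1)) (mpartial \<nu> f) \<le> C * fnorm l p \<alpha> \<rho> f"
    using fnorm_mpartial_le[OF l \<alpha> p] by metis
  obtain C2 where C2: "C2 < top" "\<And>(f :: complex ^ 'n \<Rightarrow> complex) x. entire f \<Longrightarrow> norm x \<le> 1 \<Longrightarrow>
      ennreal (norm (f x)) \<le> C2 * fnorm l p \<alpha> (\<rho> - real k * (2 * l - 1)) f"
    using entire_value_le_fnorm[OF l p] by metis
  define N where "N = card {\<nu> :: 'n \<Rightarrow> nat. sum \<nu> UNIV = k}"
  have "ennreal (nabla_abs k f 0) \<le> (of_nat N * (C2 * C)) * fnorm l p \<alpha> \<rho> f"
    if f: "entire f" for f :: "complex ^ 'n \<Rightarrow> complex"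
  proof -
    have "ennreal (nabla_abs k f 0) = (\<Sum>\<nu> | sum \<nu> UNIV = k. ennreal (norm (mpartial \<nu> f 0)))"
      by (simp add: nabla_abs_def sum_ennreal)
    also have "\<dots> \<le> (\<Sum>\<nu> :: 'n \<Rightarrow> nat | sum \<nu> UNIV = k. C2 * (C * fnorm l p \<alpha> \<rho> f))"
    proof (rule sum_mono)
      fix \<nu> :: "'n \<Rightarrow> nat" assume "\<nu> \<in> {\<nu>. sum \<nu> UNIV = k}"
      then have \<nu>: "sum \<nu> UNIV = k" by simp
      have "ennreal (norm (mpartial \<nu> f 0)) \<le> C2 * fnorm l p \<alpha> (\<rho> - real k * (2 * l - 1)) (mpartial \<nu> f)"
        by (rule C2(2)[OF entire_mpartial[OF f]]) simp
      also have "\<dots> \<le> C2 * (C * fnorm l p \<alpha> \<rho> f)"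
        by (intro mult_left_mono C(2) f \<nu>) simp
      finally show "ennreal (norm (mpartial \<nu> f 0)) \<le> C2 * (C * fnorm l p \<alpha> \<rho> f)" .
    qed
    finally show ?thesis by (simp add: N_def mult.assoc)
  qed
  moreover have "of_nat N * (C2 * C) < top" using C(1) C2(1) by (simp add: ennreal_mult_less_top of_nat_less_top)
  ultimately show ?thesis using that by blast
qed

lemma fnorm_nabla_abs_le_Suc:
  assumes l: "1 \<le> l" and \<alpha>: "0 < \<alpha>" and p: "1 \<le> p"
  obtains C where "C < top" "\<And>f :: complex ^ 'n \<Rightarrow> complex. entire f \<Longrightarrow>
    fnorm l p \<alpha> \<rho> (nabla_abs k f) \<le> C * (ennreal (nabla_abs k f 0) + fnorm l p \<alpha> (\<rho> - (2 * l - 1)) (nabla_abs (Suc k) f))"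
proof -
  obtain C where C: "C < top" "\<And>f :: complex ^ 'n \<Rightarrow> complex. entire f \<Longrightarrow>
      fnorm l p \<alpha> \<rho> f \<le> C * (ennreal (norm (f 0)) + (\<Sum>j\<in>UNIV. fnorm l p \<alpha> (\<rho> - (2 * l - 1)) (partial j f)))"
    using fnorm_le_value_partials[OF l \<alpha> p] by metis
  define N where "N = card {\<nu> :: 'n \<Rightarrow> nat. sum \<nu> UNIV = k}"
  define d where "d = CARD('n)"
  have d: "1 \<le> (of_nat d :: ennreal)" by (simp add: d_def Suc_le_eq)
  have "fnorm l p \<alpha> \<rho> (nabla_abs k f) \<le> (of_nat N * (C * of_nat d))
      * (ennreal (nabla_abs k f 0) + fnorm l p \<alpha> (\<rho> - (2 * l - 1)) (nabla_abs (Suc k) f))"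
    if f: "entire f" for f :: "complex ^ 'n \<Rightarrow> complex"
  proof -
    define Y where "Y = fnorm l p \<alpha> (\<rho> - (2 * l - 1)) (nabla_abs (Suc k) f)"
    have "fnorm l p \<alpha> \<rho> (nabla_abs k f) \<le> (\<Sum>\<nu> | sum \<nu> UNIV = k. fnorm l p \<alpha> \<rho> (mpartial \<nu> f))"
      by (rule fnorm_nabla_abs_le_sum[OF l p f])
    also have "\<dots> \<le> (\<Sum>\<nu> :: 'n \<Rightarrow> nat | sum \<nu> UNIV = k. C * of_nat d * (ennreal (nabla_abs k f 0) + Y))"
    proof (rule sum_mono)
      fix \<nu> :: "'n \<Rightarrow> nat" assume "\<nu> \<in> {\<nu>. sum \<nu> UNIV = k}"
      then have \<nu>: "sum \<nu> UNIV = k" by simp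
      have "fnorm l p \<alpha> \<rho> (mpartial \<nu> f) \<le> C * (ennreal (norm (mpartial \<nu> f 0))
          + (\<Sum>j\<in>UNIV. fnorm l p \<alpha> (\<rho> - (2 * l - 1)) (partial j (mpartial \<nu> f))))"
        by (rule C(2)[OF entire_mpartial[OF f]])
      also have "\<dots> \<le> C * (ennreal (nabla_abs k f 0) + (\<Sum>j\<in>(UNIV :: 'n set). Y))"
      proof (intro mult_left_mono add_mono sum_mono ennreal_leI norm_mpartial_le_nabla_abs \<nu>)
        fix j
        show "fnorm l p \<alpha> (\<rho> - (2 * l - 1)) (partial j (mpartial \<nu> f)) \<le> Y"
          unfolding Y_def partial_mpartial[OF f]
          by (rule fnorm_mpartial_le_nabla_abs[OF l p f]) (simp only: sum_fun_upd_Suc \<nu>)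
      qed simp
      also have "\<dots> \<le> C * (of_nat d * ennreal (nabla_abs k f 0) + of_nat d * Y)"
        using mult_right_mono[OF d, of "ennreal (nabla_abs k f 0)"]
        by (intro mult_left_mono add_mono) (simp_all add: d_def)
      finally show "fnorm l p \<alpha> \<rho> (mpartial \<nu> f) \<le> C * of_nat d * (ennreal (nabla_abs k f 0) + Y)"
        by (simp add: mult.assoc distrib_left)
    qed
    finally show ?thesis by (simp add: N_def Y_def mult.assoc)
  qed
  moreover have "of_nat N * (C * of_nat d) < top" using C(1) by (simp add: ennreal_mult_less_top of_nat_less_top)
  ultimately show ?thesis using that by blast
qed

text \<open>Each step replaces the norm of order \<open>k\<close> by the value of \<open>nabla_abs k f\<close> at \<open>0\<close> and the norm of order
  \<open>k + 1\<close>, whose weight index is lower by \<open>2 * l - 1\<close>.\<close>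

lemma fnorm_le_jet_nabla_abs:
  assumes l: "1 \<le> l" and \<alpha>: "0 < \<alpha>" and p: "1 \<le> p"
  shows "\<exists>C<top. \<forall>f :: complex ^ 'n \<Rightarrow> complex. entire f \<longrightarrow>
    fnorm l p \<alpha> \<rho> f \<le> C * (ennreal (\<Sum>m<k. nabla_abs m f 0) + fnorm l p \<alpha> (\<rho> - real k * (2 * l - 1)) (nabla_abs k f))"
proof (induction k)
  case 0
  then show ?case
    by (intro exI[of _ 1]) (simp add: fnorm_def nabla_abs_0)
next
  case (Suc k)
  then obtain C where C: "C < top" "\<And>f :: complex ^ 'n \<Rightarrow> complex. entire f \<Longrightarrow> fnorm l p \<alpha> \<rho> f
      \<le> C * (ennreal (\<Sum>m<k. nabla_abs m f 0) + fnorm l p \<alpha> (\<rho> - real k * (2 * l - 1)) (nabla_abs k f))"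
    by blast
  obtain C' where C': "C' < top" "\<And>f :: complex ^ 'n \<Rightarrow> complex. entire f \<Longrightarrow>
      fnorm l p \<alpha> (\<rho> - real k * (2 * l - 1)) (nabla_abs k f) \<le> C' * (ennreal (nabla_abs k f 0)
        + fnorm l p \<alpha> ((\<rho> - real k * (2 * l - 1)) - (2 * l - 1)) (nabla_abs (Suc k) f))"
    using fnorm_nabla_abs_le_Suc[OF l \<alpha> p] by metis
  have index: "\<rho> - real (Suc k) * (2 * l - 1) = (\<rho> - real k * (2 * l - 1)) - (2 * l - 1)"
    by (simp add: algebra_simps)
  have "fnorm l p \<alpha> \<rho> f \<le> (C * (1 + C'))
      * (ennreal (\<Sum>m<Suc k. nabla_abs m f 0) + fnorm l p \<alpha> (\<rho> - real (Suc k) * (2 * l - 1)) (nabla_abs (Suc k) f))"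
    if f: "entire f" for f :: "complex ^ 'n \<Rightarrow> complex"
  proof -
    define a where "a = ennreal (\<Sum>m<k. nabla_abs m f 0)"
    define b where "b = ennreal (nabla_abs k f 0)"
    define Y where "Y = fnorm l p \<alpha> (\<rho> - real (Suc k) * (2 * l - 1)) (nabla_abs (Suc k) f)"
    have ab: "ennreal (\<Sum>m<Suc k. nabla_abs m f 0) = a + b"
      by (simp add: a_def b_def nabla_abs_nonneg sum_nonneg)
    have "fnorm l p \<alpha> \<rho> f \<le> C * (a + fnorm l p \<alpha> (\<rho> - real k * (2 * l - 1)) (nabla_abs k f))"
      unfolding a_def by (rule C(2)[OF f])
    also have "\<dots> \<le> C * (a + C' * (b + Y))"
      unfolding b_def Y_def index by (intro mult_left_mono add_left_mono C'(2) f) simp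
    also have "\<dots> \<le> C * ((a + b + Y) + C' * (a + b + Y))"
      by (intro mult_left_mono add_mono) (simp_all add: add.assoc add_increasing)
    finally show ?thesis unfolding ab Y_def[symmetric] by (simp add: mult.assoc distrib_right)
  qed
  moreover have "C * (1 + C') < top" using C(1) C'(1) by (simp add: ennreal_mult_less_top)
  ultimately show ?case by blast
qed

lemma jet_nabla_abs_le_fnorm:
  assumes l: "1 \<le> l" and \<alpha>: "0 < \<alpha>" and p: "1 \<le> p"
  obtains C where "C < top" "\<And>f :: complex ^ 'n \<Rightarrow> complex. entire f \<Longrightarrow>
    ennreal (\<Sum>m<k. nabla_abs m f 0) + fnorm l p \<alpha> (\<rho> - real k * (2 * l - 1)) (nabla_abs k f) \<le> C * fnorm l p \<alpha> \<rho> f"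
proof -
  obtain C1 where C1: "C1 < top" "\<And>f :: complex ^ 'n \<Rightarrow> complex. entire f \<Longrightarrow>
    fnorm l p \<alpha> (\<rho> - real k * (2 * l - 1)) (nabla_abs k f) \<le> C1 * fnorm l p \<alpha> \<rho> f"
    using fnorm_nabla_abs_le[OF l \<alpha> p] by metis
  have "\<forall>m. \<exists>C<top. \<forall>f :: complex ^ 'n \<Rightarrow> complex. entire f \<longrightarrow> ennreal (nabla_abs m f 0) \<le> C * fnorm l p \<alpha> \<rho> f"
    using nabla_abs_0_le_fnorm[OF l \<alpha> p] by metis
  then obtain c where c: "\<And>m. c m < top" "\<And>m (f :: complex ^ 'n \<Rightarrow> complex). entire f \<Longrightarrow> ennreal (nabla_abs m f 0) \<le> c m * fnorm l p \<alpha> \<rho> f"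
    by metis
  have "ennreal (\<Sum>m<k. nabla_abs m f 0) + fnorm l p \<alpha> (\<rho> - real k * (2 * l - 1)) (nabla_abs k f)
      \<le> ((\<Sum>m<k. c m) + C1) * fnorm l p \<alpha> \<rho> f" if f: "entire f" for f :: "complex ^ 'n \<Rightarrow> complex"
  proof -
    have "ennreal (\<Sum>m<k. nabla_abs m f 0) = (\<Sum>m<k. ennreal (nabla_abs m f 0))"
      by (simp add: sum_ennreal nabla_abs_nonneg)
    also have "\<dots> \<le> (\<Sum>m<k. c m) * fnorm l p \<alpha> \<rho> f"
      unfolding sum_distrib_right by (intro sum_mono c f)
    finally show ?thesis using C1(2)[OF f] by (simp add: distrib_right add_mono)
  qed
  moreover have "(\<Sum>m<k. c m) + C1 < top" using c(1) C1(1) by simp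
  ultimately show ?thesis using that by blast
qed

section \<open>The norm equivalence\<close>

lemma borel_measurable_dV:
  fixes g :: "complex ^ 'n::finite \<Rightarrow> 'b::topological_space"
  assumes "g \<in> borel_measurable borel"
  shows "g \<in> borel_measurable dV"
proof -
  have "borel_measurable (dV :: (complex ^ 'n) measure) = (borel_measurable lebesgue :: (_ \<Rightarrow> 'b) set)"
    by (rule measurable_cong_sets) (simp_all only: dV_def sets_scale_measure)
  then show ?thesis
    using measurable_completion[of g lborel borel] assms by simp
qed

text \<open>The measure \<^const>\<open>dV\<close> is a constant \<open>c\<close> times Lebesgue measure, so \<open>\<kappa> = c\<^sup>1\<^sup>/\<^sup>p\<close>, and \<open>\<kappa> = 1\<close> for
  \<open>p = \<infinity>\<close>, since only null sets matter then.\<close>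

lemma wnorm_eq_fnorm:
  assumes l: "1 \<le> l" and p: "1 \<le> p"
  obtains \<kappa> where "0 < \<kappa>" "\<And>f :: complex ^ 'n::finite \<Rightarrow> 'b::real_normed_vector. continuous_on UNIV f \<Longrightarrow>
    wnorm l p \<alpha> \<rho> f = ennreal \<kappa> * fnorm l p \<alpha> \<rho> f"
proof -
  define c where "c = inverse (emeasure lebesgue (ball (0 :: complex ^ 'n) 1))"
  have c: "0 < c" "c < \<infinity>"
    using emeasure_unit_ball[where 'a = "complex ^ 'n"]
    by (simp_all add: c_def less_top[symmetric] ennreal_inverse_positive)
  have dV_c: "dV = scale_measure c (lebesgue :: (complex ^ 'n) measure)"
    by (simp only: dV_def c_def)
  have g_meas: "(\<lambda>z. norm (f z) * weight l \<alpha> \<rho> z) \<in> borel_measurable borel"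
    if "continuous_on UNIV f" for f :: "complex ^ 'n \<Rightarrow> 'b"
    by (intro borel_measurable_continuous_onI continuous_on_mult continuous_on_norm continuous_on_weight that l)
  show ?thesis
  proof (cases "p = \<infinity>")
    case True
    have "wnorm l p \<alpha> \<rho> f = ennreal 1 * fnorm l p \<alpha> \<rho> f" if f: "continuous_on UNIV f" for f :: "complex ^ 'n \<Rightarrow> 'b"
    proof -
      define g where "g = (\<lambda>z. ennreal (norm (f z) * weight l \<alpha> \<rho> z))"
      have g: "g \<in> borel_measurable borel" unfolding g_def
        by (rule measurable_compose[OF g_meas[OF f] measurable_ennreal])
      have gL: "g \<in> borel_measurable dV" by (rule borel_measurable_dV[OF g])
      have "(AE z in dV. g z \<le> y) \<longleftrightarrow> (AE z in lborel. g z \<le> y)" for y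
      proof -
        have null: "{z. \<not> g z \<le> y} \<in> sets borel"
          using measurable_sets[OF g, of "{y<..}"] by (simp add: vimage_def not_le)
        have "(AE z in dV. g z \<le> y) \<longleftrightarrow> emeasure dV {z. \<not> g z \<le> y} = 0"
          by (rule AE_iff_measurable) (use null in \<open>simp_all add: dV_c space_scale_measure\<close>)
        also have "\<dots> \<longleftrightarrow> emeasure lborel {z. \<not> g z \<le> y} = 0"
          using c null by (auto simp: dV_c)
        also have "\<dots> \<longleftrightarrow> (AE z in lborel. g z \<le> y)"
          by (rule AE_iff_measurable[symmetric]) (use null in auto)
        finally show ?thesis .
      qed
      then have "esssup dV g = esssup lborel g"
        using g gL by (simp add: esssup_eq_AE)
      then show ?thesis
        using True by (simp add: wnorm_def fnorm_def Lnorm_def g_def weight_def mult.assoc)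
    qed
    then show ?thesis using that[of 1] by simp
  next
    case False
    define q where "q = enn2real p"
    have q: "1 \<le> q" using p False exponent_ge_1 q_def by blast
    define \<kappa> where "\<kappa> = enn2real c powr (1 / q)"
    have "wnorm l p \<alpha> \<rho> f = ennreal \<kappa> * fnorm l p \<alpha> \<rho> f" if f: "continuous_on UNIV f" for f :: "complex ^ 'n \<Rightarrow> 'b"
    proof -
      define g where "g = (\<lambda>z. norm (f z) * weight l \<alpha> \<rho> z)"
      have g [measurable]: "g \<in> borel_measurable borel" unfolding g_def by (rule g_meas[OF f])
      have gq: "(\<lambda>z. ennreal (g z powr q)) \<in> borel_measurable lborel" by measurable
      have "(\<integral>\<^sup>+z. ennreal (g z powr q) \<partial>dV) = c * (\<integral>\<^sup>+z. ennreal (g z powr q) \<partial>lebesgue)"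
        unfolding dV_c by (rule nn_integral_scale_measure) (rule measurable_completion[OF gq])
      also have "\<dots> = c * (\<integral>\<^sup>+z. epow (ennreal (g z)) q \<partial>lborel)"
        by (simp add: nn_integral_completion epow_ennreal g_def)
      finally have "epow (\<integral>\<^sup>+z. ennreal (g z powr q) \<partial>dV) (1 / q)
          = epow c (1 / q) * epow (\<integral>\<^sup>+z. epow (ennreal (g z)) q \<partial>lborel) (1 / q)"
        using q by (simp add: epow_mult)
      moreover have "epow c (1 / q) = ennreal \<kappa>"
        using c by (simp add: epow_def \<kappa>_def)
      moreover have "wnorm l p \<alpha> \<rho> f = epow (\<integral>\<^sup>+z. ennreal (g z powr q) \<partial>dV) (1 / q)"
        using False by (simp add: wnorm_def epow_def g_def weight_def q_def Let_def mult.assoc)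
      ultimately show ?thesis
        using False by (simp add: fnorm_def Lnorm_def q_def g_def)
    qed
    moreover have "0 < \<kappa>" using c by (auto simp: \<kappa>_def enn2real_eq_0_iff)
    ultimately show ?thesis using that by blast
  qed
qed

lemma wnorm_equivalence:
  assumes l: "1 \<le> l" and p: "1 \<le> p" and \<alpha>: "0 < \<alpha>"
  shows "\<exists>C::real. C > 0 \<and> (\<forall>f :: complex ^ 'n::finite \<Rightarrow> complex. entire f \<longrightarrow>
    (let \<Phi> = wnorm l p \<alpha> \<rho> f;
         \<Psi> = ennreal (\<Sum>m<k. nabla_abs m f 0) + wnorm l p \<alpha> (\<rho> - real k * (2 * l - 1)) (nabla_abs k f)
     in ennreal (inverse C) * \<Psi> \<le> \<Phi> \<and> \<Phi> \<le> ennreal C * \<Psi>))"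
proof -
  let ?\<sigma> = "\<rho> - real k * (2 * l - 1)"
  obtain a where a: "0 < a" "\<And>f :: complex ^ 'n \<Rightarrow> complex. continuous_on UNIV f \<Longrightarrow>
      wnorm l p \<alpha> \<rho> f = ennreal a * fnorm l p \<alpha> \<rho> f"
    using wnorm_eq_fnorm[OF l p] by metis
  obtain b where b: "0 < b" "\<And>f :: complex ^ 'n \<Rightarrow> real. continuous_on UNIV f \<Longrightarrow>
      wnorm l p \<alpha> ?\<sigma> f = ennreal b * fnorm l p \<alpha> ?\<sigma> f"
    using wnorm_eq_fnorm[OF l p] by metis
  obtain K where K: "K < top" "\<And>f :: complex ^ 'n \<Rightarrow> complex. entire f \<Longrightarrow>
      ennreal (\<Sum>m<k. nabla_abs m f 0) + fnorm l p \<alpha> ?\<sigma> (nabla_abs k f) \<le> K * fnorm l p \<alpha> \<rho> f"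
    using jet_nabla_abs_le_fnorm[OF l \<alpha> p] by metis
  obtain L where L: "L < top" "\<And>f :: complex ^ 'n \<Rightarrow> complex. entire f \<Longrightarrow>
      fnorm l p \<alpha> \<rho> f \<le> L * (ennreal (\<Sum>m<k. nabla_abs m f 0) + fnorm l p \<alpha> ?\<sigma> (nabla_abs k f))"
    using fnorm_le_jet_nabla_abs[OF l \<alpha> p] by metis
  have a_inv: "ennreal (1 / a) * ennreal a = 1" and b_inv: "ennreal (1 / b) * ennreal b = 1"
    using a(1) b(1) by (simp_all add: ennreal_mult'[symmetric])
  define E1 where "E1 = (1 + ennreal b) * K * ennreal (1 / a)"
  define E2 where "E2 = ennreal a * L * (1 + ennreal (1 / b))"
  have E: "E1 < top" "E2 < top" using K(1) L(1) by (simp_all add: E1_def E2_def ennreal_mult_less_top)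
  define C where "C = 1 + enn2real E1 + enn2real E2"
  have C: "0 < C" by (simp add: C_def add_pos_nonneg)
  have EC: "E1 \<le> ennreal C" "E2 \<le> ennreal C"
    using E by (auto simp: C_def add_increasing add_increasing2 ennreal_enn2real)
  have "ennreal (inverse C) * \<Psi> \<le> \<Phi> \<and> \<Phi> \<le> ennreal C * \<Psi>"
    if f: "entire f" and Phi: "\<Phi> = wnorm l p \<alpha> \<rho> f"
      and Psi: "\<Psi> = ennreal (\<Sum>m<k. nabla_abs m f 0) + wnorm l p \<alpha> ?\<sigma> (nabla_abs k f)"
    for f :: "complex ^ 'n \<Rightarrow> complex" and \<Phi> \<Psi>
  proof -
    define A where "A = ennreal (\<Sum>m<k. nabla_abs m f 0)"
    define X where "X = fnorm l p \<alpha> ?\<sigma> (nabla_abs k f)"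
    define F where "F = fnorm l p \<alpha> \<rho> f"
    have Phi': "\<Phi> = ennreal a * F" unfolding Phi F_def by (rule a(2)[OF continuous_on_entire[OF f]])
    have Psi': "\<Psi> = A + ennreal b * X" unfolding Psi X_def A_def b(2)[OF continuous_on_nabla_abs[OF f]] ..
    have F: "F = ennreal (1 / a) * \<Phi>" by (simp add: Phi' mult.assoc[symmetric] a_inv)
    have X: "X = ennreal (1 / b) * (ennreal b * X)" by (simp add: mult.assoc[symmetric] b_inv)
    have "\<Psi> \<le> (1 + ennreal b) * (A + X)"
      unfolding Psi' distrib_left distrib_right by (simp add: add_increasing2 add_mono add.assoc add_increasing)
    also have "\<dots> \<le> (1 + ennreal b) * (K * F)"
      unfolding A_def X_def F_def by (intro mult_left_mono K(2) f) simp
    also have "\<dots> = E1 * \<Phi>" unfolding F E1_def by (simp only: mult.assoc)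
    also have "\<dots> \<le> ennreal C * \<Phi>" by (intro mult_right_mono EC) simp
    finally have "ennreal (inverse C) * \<Psi> \<le> ennreal (inverse C) * (ennreal C * \<Phi>)"
      by (rule mult_left_mono) simp
    also have "\<dots> = \<Phi>" using C by (simp add: mult.assoc[symmetric] ennreal_mult'[symmetric])
    finally have lower: "ennreal (inverse C) * \<Psi> \<le> \<Phi>" .
    have AX: "A + X \<le> (1 + ennreal (1 / b)) * \<Psi>"
    proof -
      have "A + X = A + ennreal (1 / b) * (ennreal b * X)" using X by simp
      also have "\<dots> \<le> \<Psi> + ennreal (1 / b) * \<Psi>"
        by (intro add_mono mult_left_mono) (simp_all add: Psi')
      finally show ?thesis by (simp add: distrib_right)
    qed
    have "\<Phi> \<le> ennreal a * (L * (A + X))"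
      unfolding Phi' A_def X_def F_def by (intro mult_left_mono L(2) f) simp
    also have "\<dots> \<le> ennreal a * (L * ((1 + ennreal (1 / b)) * \<Psi>))"
      by (intro mult_left_mono AX) simp_all
    also have "\<dots> = E2 * \<Psi>" unfolding E2_def by (simp only: mult.assoc)
    also have "\<dots> \<le> ennreal C * \<Psi>" by (intro mult_right_mono EC) simp
    finally show ?thesis using lower by simp
  qed
  with C show ?thesis unfolding Let_def by blast
qed

theorem theorem1p4:
  fixes l \<alpha> \<rho> :: real and p :: ennreal
  assumes "1 \<le> l" and "1 \<le> p" and "0 < \<alpha>"
  shows "(\<forall>f :: complex ^ 'n::finite \<Rightarrow> complex. entire f \<longrightarrow>
      (f \<in> Fock l p \<alpha> \<rho> \<longleftrightarrow>
        (\<forall>k::nat. k \<ge> 1 \<longrightarrow> nabla_abs k f \<in> Lspace l p \<alpha> (\<rho> - real k * (2 * l - 1)))) \<and>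
      (f \<in> Fock l p \<alpha> \<rho> \<longleftrightarrow>
        (\<exists>k::nat. k \<ge> 1 \<and> nabla_abs k f \<in> Lspace l p \<alpha> (\<rho> - real k * (2 * l - 1))))) \<and>
    (\<forall>k::nat. k \<ge> 1 \<longrightarrow> (\<exists>C::real. C > 0 \<and>
      (\<forall>f :: complex ^ 'n \<Rightarrow> complex. entire f \<longrightarrow>
        (let \<Phi> = wnorm l p \<alpha> \<rho> f;
             \<Psi> = ennreal (\<Sum>m<k. nabla_abs m f 0)
               + wnorm l p \<alpha> (\<rho> - real k * (2 * l - 1)) (nabla_abs k f)
         in ennreal (inverse C) * \<Psi> \<le> \<Phi> \<and> \<Phi> \<le> ennreal C * \<Psi>))))"
proof -
  have membership: "f \<in> Fock l p \<alpha> \<rho> \<longleftrightarrow> nabla_abs k f \<in> Lspace l p \<alpha> (\<rho> - real k * (2 * l - 1))"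
    if f: "entire f" for f :: "complex ^ 'n \<Rightarrow> complex" and k
  proof -
    define \<Phi> where "\<Phi> = wnorm l p \<alpha> \<rho> f"
    define X where "X = wnorm l p \<alpha> (\<rho> - real k * (2 * l - 1)) (nabla_abs k f)"
    define jet where "jet = (\<Sum>m<k. nabla_abs m f 0)"
    obtain C where C: "0 < C" "ennreal (inverse C) * (ennreal jet + X) \<le> \<Phi>" "\<Phi> \<le> ennreal C * (ennreal jet + X)"
      using wnorm_equivalence[OF assms, where 'n = 'n, of \<rho> k] f unfolding Let_def \<Phi>_def X_def jet_def by blast
    have "\<Phi> < \<infinity> \<longleftrightarrow> X < \<infinity>"
    proof
      assume "\<Phi> < \<infinity>"
      with C(2) have "ennreal (inverse C) * (ennreal jet + X) < top" by simp
      then show "X < \<infinity>" using C(1) by (auto simp: ennreal_mult_less_top)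
    next
      assume "X < \<infinity>"
      then have "ennreal C * (ennreal jet + X) < \<infinity>" by (simp add: ennreal_mult_less_top)
      with C(3) show "\<Phi> < \<infinity>" by (rule le_less_trans)
    qed
    then have "wnorm l p \<alpha> \<rho> f < \<infinity> \<longleftrightarrow> wnorm l p \<alpha> (\<rho> - real k * (2 * l - 1)) (nabla_abs k f) < \<infinity>"
      unfolding \<Phi>_def X_def .
    moreover have "f \<in> borel_measurable lebesgue"
      using measurable_completion[of f lborel borel] entire_measurable[OF f] by simp
    moreover have "nabla_abs k f \<in> borel_measurable lebesgue"
      using measurable_completion[of "nabla_abs k f" lborel borel]
        borel_measurable_continuous_onI[OF continuous_on_nabla_abs[OF f]] by simp
    ultimately show ?thesis using f by (simp add: Fock_def Lspace_def)
  qed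
  have "\<exists>k::nat. 1 \<le> k" by blast
  with membership wnorm_equivalence[OF assms, where 'n = 'n, of \<rho>] show ?thesis by blast
qed

end
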